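(* In the setting of the context, suppose $-d\in J$ and that the function $$M_{aver}(\alpha):=f(\alpha,0)+h(H^{-1}(-d))\int_0^1\gamma(t)\,dt$$ has a simple zero at some $\alpha_0\in\mathbb R$ (i.e. $M_{aver}(\alpha_0)=0$, $M_{aver}'(\alpha_0)\ne0$). Then for every sufficiently small $\varepsilon>0$ the equation $$\ddot\psi=\varepsilon f(\psi,\varepsilon)+\varepsilon\gamma(t)\,h\Big(H^{-1}\Big(\tfrac{\dot\psi^2}{2}-\varepsilon F(\psi,\varepsilon)-d\Big)\Big)$$ has a unique $1$-periodic solution of the form $\psi(t)=\alpha_0+O(\varepsilon)$. Explicitly: for every sufficiently large constant $C>0$ there is $\varepsilon_0>0$ such that for every $0<\varepsilon<\varepsilon_0$ there is exactly one $1$-periodic solution $\psi$ with $\|\psi-\alpha_0\|_2\le C\varepsilon$.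
   Context: Setting: $f:\mathbb R\times\mathbb R\to\mathbb R$, $(\psi,\varepsilon)\mapsto f(\psi,\varepsilon)$, and $h:\mathbb R\to\mathbb R$ are $C^2$; $\gamma:\mathbb R\to\mathbb R$ is $C^2$ and $1$-periodic; $d\in\mathbb R$ is a fixed constant; $F(\psi,\varepsilon)=\int_0^\psi f(u,\varepsilon)\,du$, $H(z)=\int_0^z h(u)\,du$. It is assumed that $I,J\subseteq\mathbb R$ are open intervals and $H:I\to J$ is a diffeomorphism of $I$ onto $J$ (so $h\ne0$ on $I$), with inverse $H^{-1}:J\to I$. A solution is a $C^2$ function $\psi:\mathbb R\to\mathbb R$ satisfying the equation with $\frac{\dot\psi(t)^2}{2}-\varepsilon F(\psi(t),\varepsilon)-d\in J$ for all $t$. The norm is $\|u\|_2=\max\{\sup|u|,\sup|\dot u|,\sup|\ddot u|\}$. *)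

theory Defs
  imports "HOL-Analysis.Analysis"
begin

text \<open>
  Continuous differentiability of order \<open>k\<close> on an \<^emph>\<open>open\<close> set: all iterated directional
  derivatives up to order \<open>k\<close> exist as Frechet derivatives and are continuous.
  In one real variable \<open>frechet_derivative f (at x) v = v * deriv f x\<close>.
\<close>

fun Ck_on :: "nat \<Rightarrow> ('a::euclidean_space \<Rightarrow> real) \<Rightarrow> 'a set \<Rightarrow> bool" where
  "Ck_on 0 f S \<longleftrightarrow> continuous_on S f"
| "Ck_on (Suc k) f S \<longleftrightarrow>
     (\<forall>x\<in>S. f differentiable (at x)) \<and>
     (\<forall>v. Ck_on k (\<lambda>x. frechet_derivative f (at x) v) S)"

definition diffeo_onto :: "(real \<Rightarrow> real) \<Rightarrow> real set \<Rightarrow> real set \<Rightarrow> bool" where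
  "diffeo_onto g I J \<longleftrightarrow>
     bij_betw g I J \<and> Ck_on 1 g I \<and> Ck_on 1 (inv_into I g) J"

text \<open>
  The interval integral is oriented, so the two primitives below are the usual ones
  for negative upper limits as well.
\<close>

definition F_prim :: "(real \<times> real \<Rightarrow> real) \<Rightarrow> real \<Rightarrow> real \<Rightarrow> real" where
  "F_prim f \<psi> \<epsilon> = (LBINT u=0..\<psi>. f (u, \<epsilon>))"

definition H_prim :: "(real \<Rightarrow> real) \<Rightarrow> real \<Rightarrow> real" where
  "H_prim h z = (LBINT u=0..z. h u)"

definition energy ::
  "(real \<times> real \<Rightarrow> real) \<Rightarrow> real \<Rightarrow> real \<Rightarrow> (real \<Rightarrow> real) \<Rightarrow> real \<Rightarrow> real" where
  "energy f d \<epsilon> \<psi> t = (deriv \<psi> t)\<^sup>2 / 2 - \<epsilon> * F_prim f (\<psi> t) \<epsilon> - d"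

definition is_solution ::
  "(real \<times> real \<Rightarrow> real) \<Rightarrow> (real \<Rightarrow> real) \<Rightarrow> (real \<Rightarrow> real) \<Rightarrow> real \<Rightarrow> real set \<Rightarrow> real set \<Rightarrow>
   real \<Rightarrow> (real \<Rightarrow> real) \<Rightarrow> bool" where
  "is_solution f h \<gamma> d I J \<epsilon> \<psi> \<longleftrightarrow>
     Ck_on 2 \<psi> UNIV \<and>
     (\<forall>t. energy f d \<epsilon> \<psi> t \<in> J) \<and>
     (\<forall>t. deriv (deriv \<psi>) t =
        \<epsilon> * f (\<psi> t, \<epsilon>) + \<epsilon> * \<gamma> t * h (inv_into I (H_prim h) (energy f d \<epsilon> \<psi> t)))"

definition one_periodic :: "(real \<Rightarrow> real) \<Rightarrow> bool" where
  "one_periodic u \<longleftrightarrow> (\<forall>t. u (t + 1) = u t)"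

text \<open>
  The real-valued suprema are meaningful only when bounded; the norm is used only for
  periodic \<open>C\<^sup>2\<close> functions.
\<close>

definition C2_norm :: "(real \<Rightarrow> real) \<Rightarrow> real" where
  "C2_norm u = Max {SUP t. \<bar>u t\<bar>, SUP t. \<bar>deriv u t\<bar>, SUP t. \<bar>deriv (deriv u) t\<bar>}"

definition M_aver ::
  "(real \<times> real \<Rightarrow> real) \<Rightarrow> (real \<Rightarrow> real) \<Rightarrow> (real \<Rightarrow> real) \<Rightarrow> real \<Rightarrow> real set \<Rightarrow> real \<Rightarrow> real" where
  "M_aver f h \<gamma> d I \<alpha> =
     f (\<alpha>, 0) + h (inv_into I (H_prim h) (-d)) * (LBINT t=0..1. \<gamma> t)"

end

theory Submission
  imports Defs
begin

text \<open>
  Write \<open>\<psi> = \<alpha>\<^sub>0 + \<epsilon> x\<close>; the equation becomes \<open>x'' = N t x x'\<close> with \<open>N t 0 0\<close> bounded, the mean of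
  \<open>N t 0 0\<close> of order \<open>\<epsilon>\<close> (as \<open>\<alpha>\<^sub>0\<close> is a zero of \<open>M_aver\<close>), and
  \<open>N t x\<^sub>1 y\<^sub>1 - N t x\<^sub>2 y\<^sub>2 = k (x\<^sub>1 - x\<^sub>2) + o(\<epsilon>)\<close> where \<open>k = \<epsilon> M_aver' \<alpha>\<^sub>0 \<noteq> 0\<close>.
  A periodic \<open>x\<close> is encoded by \<open>z = x'' + mean x\<close>. Periodic solutions are the fixed points of
  \<open>T z = (N - mean N) + (mean z - mean N / k)\<close>: taking means in \<open>T z = z\<close> forces \<open>mean N = 0\<close>.
  In \<open>mean z - mean N / k\<close> the linear part of \<open>N\<close> cancels, so \<open>T\<close> is a contraction in the sup norm
  on every fixed ball once \<open>\<epsilon>\<close> is small.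
\<close>

subsection \<open>Primitives of periodic functions\<close>

lemma H_prim_0 [simp]: "H_prim w 0 = 0"
  by (simp add: H_prim_def zero_ereal_def[symmetric])

lemma H_prim_has_derivative:
  assumes "continuous_on UNIV w"
  shows "(H_prim w has_real_derivative w t) (at t)"
proof -
  \<comment> \<open>The margin of 1 puts \<open>t\<close> in the interior, so the derivative within
    the interval is the two-sided one.\<close>
  let ?a = "min 0 t - 1" and ?b = "max 0 t + 1"
  have "((\<lambda>u. LBINT y=ereal 0..ereal u. w y) has_vector_derivative w t) (at t within {?a..?b})"
    by (rule interval_integral_FTC2) (auto intro: continuous_on_subset[OF assms])
  moreover have "at t within {?a..?b} = at t"
    by (rule at_within_Icc_at) auto
  ultimately show ?thesis
    by (simp add: H_prim_def[abs_def] zero_ereal_def has_real_derivative_iff_has_vector_derivative)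
qed

lemma has_derivative_imp_continuous:
  assumes "\<And>t. (W has_real_derivative w t) (at t)"
  shows "continuous_on S W"
  using assms DERIV_isCont continuous_at_imp_continuous_on by blast

lemma continuous_H_prim:
  "continuous_on UNIV w \<Longrightarrow> continuous_on UNIV (H_prim w)"
  by (rule has_derivative_imp_continuous[OF H_prim_has_derivative])

text \<open>Primitives are unique up to a constant. Linearity, periodicity and the vanishing mean of
  a periodic derivative all come from exhibiting a primitive.\<close>

lemma H_prim_eqI:
  assumes "continuous_on UNIV w" "\<And>t. (W has_real_derivative w t) (at t)"
  shows "H_prim w t = W t - W 0"
proof -
  have "((\<lambda>t. H_prim w t - W t) has_real_derivative 0) (at t)" for t
    using DERIV_diff[OF H_prim_has_derivative[OF assms(1)] assms(2)] by simp
  then have "H_prim w t - W t = H_prim w 0 - W 0"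
    by (intro DERIV_isconst_all) auto
  then show ?thesis by simp
qed

lemma H_prim_diff:
  assumes "continuous_on UNIV u" "continuous_on UNIV v"
  shows "H_prim (\<lambda>t. u t - v t) t = H_prim u t - H_prim v t"
  using assms
  by (subst H_prim_eqI[where W = "\<lambda>t. H_prim u t - H_prim v t"])
     (auto intro!: continuous_intros DERIV_diff H_prim_has_derivative)

lemma H_prim_add:
  assumes "continuous_on UNIV u" "continuous_on UNIV v"
  shows "H_prim (\<lambda>t. u t + v t) t = H_prim u t + H_prim v t"
  using assms
  by (subst H_prim_eqI[where W = "\<lambda>t. H_prim u t + H_prim v t"])
     (auto intro!: continuous_intros DERIV_add H_prim_has_derivative)

lemma H_prim_cmult:
  assumes "continuous_on UNIV u"
  shows "H_prim (\<lambda>t. c * u t) t = c * H_prim u t"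
  using assms
  by (subst H_prim_eqI[where W = "\<lambda>t. c * H_prim u t"])
     (auto intro!: continuous_intros DERIV_cmult H_prim_has_derivative)

lemma H_prim_const: "H_prim (\<lambda>_. c) t = c * t"
  by (subst H_prim_eqI[where W = "\<lambda>t. c * t"])
     (auto intro!: derivative_eq_intros continuous_intros)

text \<open>The mean value inequality, with the bound asked only between \<open>a\<close> and
  \<open>b\<close>. \<open>F_prim\<close> needs this local form, since \<open>f\<close> is known to
  be bounded only on compact sets.\<close>

lemma H_prim_Lipschitz:
  assumes "continuous_on UNIV w" "\<And>s. s \<in> closed_segment a b \<Longrightarrow> \<bar>w s\<bar> \<le> B"
  shows "\<bar>H_prim w b - H_prim w a\<bar> \<le> B * \<bar>b - a\<bar>"
proof -
  have "norm (H_prim w b - H_prim w a) \<le> B * norm (b - a)"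
    by (rule field_differentiable_bound[where S = "closed_segment a b" and f' = w])
       (auto intro: has_field_derivative_at_within H_prim_has_derivative assms)
  then show ?thesis by simp
qed

text \<open>The case \<open>t = 1\<close> bounds \<open>H_prim w 1\<close>, which is the mean of a
  1-periodic \<open>w\<close>.\<close>

lemma H_prim_bound:
  assumes "continuous_on UNIV w" "\<And>s. \<bar>w s\<bar> \<le> B" "0 \<le> t" "t \<le> 1"
  shows "\<bar>H_prim w t\<bar> \<le> B"
proof -
  have "\<bar>H_prim w t - H_prim w 0\<bar> \<le> B * \<bar>t - 0\<bar>"
    by (rule H_prim_Lipschitz) (use assms in auto)
  also have "\<dots> \<le> B * 1"
    using assms(2)[of 0] assms(3,4) by (intro mult_left_mono) auto
  finally show ?thesis by simp
qed

lemma one_periodic_frac: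
  assumes "one_periodic u"
  shows "u (frac t) = u t"
proof -
  have nat: "u (s + real n) = u s" for s n
    using assms
    by (induction n) (auto simp: one_periodic_def add.assoc[symmetric] add.commute[of 1])
  have "u (s + of_int i) = u s" for s i
    using nat[of s "nat i"] nat[of "s + of_int i" "nat (- i)"] by (cases "i \<ge> 0") auto
  from this[of "frac t" "floor t"] show ?thesis by (simp add: frac_def)
qed

lemma one_periodic_bounded:
  assumes "continuous_on UNIV u" "one_periodic u"
  obtains B where "B \<ge> 0" "\<And>t. \<bar>u t\<bar> \<le> B"
proof -
  have "compact (u ` {0..1})"
    by (intro compact_continuous_image compact_Icc continuous_on_subset[OF assms(1)]) simp
  then obtain B where B: "\<And>t. t \<in> {0..1} \<Longrightarrow> \<bar>u t\<bar> \<le> B"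
    using compact_imp_bounded[THEN bounded_iff[THEN iffD1]] by fastforce
  have *: "\<bar>u t\<bar> \<le> B" for t
    using B[of "frac t"] one_periodic_frac[OF assms(2), of t] frac_ge_0[of t] frac_lt_1[of t]
    by simp
  show ?thesis by (rule that[OF _ *]) (use *[of 0] in linarith)
qed

text \<open>The primitive shifted by a period is again a primitive of \<open>w\<close>, so the two
  differ by a constant. This constant is the mean \<open>H_prim w 1\<close>, which vanishes.\<close>

lemma H_prim_periodic:
  assumes "continuous_on UNIV w" "one_periodic w" "H_prim w 1 = 0"
  shows "one_periodic (H_prim w)"
proof -
  have "H_prim w t = H_prim w (t + 1) - H_prim w (0 + 1)" for t
  proof (rule H_prim_eqI[OF assms(1)])
    fix s
    show "((\<lambda>t. H_prim w (t + 1)) has_real_derivative w s) (at s)"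
      using DERIV_shift[THEN iffD1, OF H_prim_has_derivative[OF assms(1), of "s + 1"]]
        assms(2) by (simp add: one_periodic_def add.commute[of 1])
  qed
  then show ?thesis using assms(3) by (simp add: one_periodic_def)
qed

lemma one_periodic_derivative:
  assumes "one_periodic x" "\<And>t. (x has_real_derivative y t) (at t)"
  shows "one_periodic y"
  unfolding one_periodic_def
proof
  fix t
  have "((\<lambda>s. x (s + 1)) has_real_derivative y (t + 1)) (at t)"
    using DERIV_shift[THEN iffD1, OF assms(2)[of "t + 1"]] by (simp add: add.commute)
  moreover have "(\<lambda>s. x (s + 1)) = x" using assms(1) by (auto simp: one_periodic_def)
  ultimately show "y (t + 1) = y t" using assms(2)[of t] by (simp add: DERIV_unique)
qed

section \<open>Periodic primitives of mean zero\<close>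

definition zero_mean_prim :: "(real \<Rightarrow> real) \<Rightarrow> real \<Rightarrow> real" where
  "zero_mean_prim w t = H_prim w t - H_prim (H_prim w) 1"

lemma zero_mean_prim_has_derivative:
  "continuous_on UNIV w \<Longrightarrow> (zero_mean_prim w has_real_derivative w t) (at t)"
  unfolding zero_mean_prim_def[abs_def] by (auto intro!: derivative_eq_intros H_prim_has_derivative)

lemma continuous_zero_mean_prim: "continuous_on UNIV w \<Longrightarrow> continuous_on UNIV (zero_mean_prim w)"
  by (rule has_derivative_imp_continuous[OF zero_mean_prim_has_derivative])

lemma mean_zero_mean_prim: "continuous_on UNIV w \<Longrightarrow> H_prim (zero_mean_prim w) 1 = 0"
  unfolding zero_mean_prim_def[abs_def] by (simp add: H_prim_diff continuous_H_prim H_prim_const)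

lemma zero_mean_prim_periodic:
  "\<lbrakk>continuous_on UNIV w; one_periodic w; H_prim w 1 = 0\<rbrakk> \<Longrightarrow> one_periodic (zero_mean_prim w)"
  using H_prim_periodic[of w] by (simp add: zero_mean_prim_def one_periodic_def)

lemma zero_mean_prim_diff:
  assumes "continuous_on UNIV u" "continuous_on UNIV v"
  shows "zero_mean_prim (\<lambda>t. u t - v t) t = zero_mean_prim u t - zero_mean_prim v t"
proof -
  have "H_prim (\<lambda>t. u t - v t) = (\<lambda>t. H_prim u t - H_prim v t)"
    using H_prim_diff[OF assms] by (rule ext)
  then show ?thesis using assms by (simp add: zero_mean_prim_def H_prim_diff continuous_H_prim)
qed

text \<open>On one period the primitive and its mean are each at most \<open>B\<close>, hence the
  factor 2; periodicity carries the bound to all \<open>t\<close>.\<close>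

lemma zero_mean_prim_bound:
  assumes "continuous_on UNIV w" "one_periodic w" "H_prim w 1 = 0" "\<And>t. \<bar>w t\<bar> \<le> B"
  shows "\<bar>zero_mean_prim w t\<bar> \<le> 2 * B"
proof -
  have P: "\<bar>H_prim w t\<bar> \<le> B" for t
    using H_prim_bound[OF assms(1,4), of "frac t"]
      one_periodic_frac[OF H_prim_periodic[OF assms(1-3)], of t] frac_lt_1[of t] by simp
  have "\<bar>H_prim (H_prim w) 1\<bar> \<le> B"
    by (rule H_prim_bound[OF continuous_H_prim[OF assms(1)] P]) auto
  with P[of t] show ?thesis unfolding zero_mean_prim_def by linarith
qed

text \<open>The mean-zero condition fixes the constant of integration. This serves to recognise a
  given periodic solution in \<open>vel\<close> and \<open>pos\<close>.\<close>

lemma zero_mean_prim_eqI: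
  assumes "continuous_on UNIV w" "\<And>t. (W has_real_derivative w t) (at t)" "H_prim W 1 = 0"
  shows "zero_mean_prim w = W"
proof
  have W: "continuous_on UNIV W" by (rule has_derivative_imp_continuous[OF assms(2)])
  have "H_prim w = (\<lambda>t. W t - W 0)"
    using H_prim_eqI[OF assms(1,2)] by auto
  then show "zero_mean_prim w t = W t" for t
    using assms(3) W by (simp add: zero_mean_prim_def H_prim_diff H_prim_const)
qed

text \<open>For \<open>z = x'' + mean x\<close> these recover \<open>x'\<close> and \<open>x\<close>.\<close>

definition vel :: "(real \<Rightarrow> real) \<Rightarrow> real \<Rightarrow> real" where
  "vel z = zero_mean_prim (\<lambda>t. z t - H_prim z 1)"

definition pos :: "(real \<Rightarrow> real) \<Rightarrow> real \<Rightarrow> real" where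
  "pos z t = zero_mean_prim (vel z) t + H_prim z 1"

text \<open>A closed sup-norm ball of continuous 1-periodic functions. Keeping plain functions here
  confines the type of bounded continuous functions to the proof of
  \<open>cper_contraction\<close>.\<close>

definition cper :: "real \<Rightarrow> (real \<Rightarrow> real) set" where
  "cper R = {u. continuous_on UNIV u \<and> one_periodic u \<and> (\<forall>t. \<bar>u t\<bar> \<le> R)}"

lemma cperD:
  assumes "u \<in> cper R"
  shows "continuous_on UNIV u" "one_periodic u" "\<bar>u t\<bar> \<le> R"
  using assms by (auto simp: cper_def)

lemma cper_diff: "u \<in> cper R \<Longrightarrow> v \<in> cper R \<Longrightarrow> (\<And>t. \<bar>u t - v t\<bar> \<le> D) \<Longrightarrow>
    (\<lambda>t. u t - v t) \<in> cper D"
  by (auto simp: cper_def one_periodic_def intro!: continuous_intros)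

lemma mean_bound: "z \<in> cper R \<Longrightarrow> \<bar>H_prim z 1\<bar> \<le> R"
  by (rule H_prim_bound) (auto simp: cper_def)

lemma cper_minus_mean:
  assumes "z \<in> cper R"
  shows "(\<lambda>t. z t - H_prim z 1) \<in> cper (2 * R)"
proof -
  have "\<bar>z t - H_prim z 1\<bar> \<le> 2 * R" for t
    using mean_bound[OF assms] cperD(3)[OF assms, of t] by linarith
  then show ?thesis
    using cperD(1,2)[OF assms] by (auto simp: cper_def one_periodic_def intro!: continuous_intros)
qed

lemma mean_minus_mean:
  "z \<in> cper R \<Longrightarrow> H_prim (\<lambda>t. z t - H_prim z 1) 1 = 0"
  using cperD(1)[of z R] by (simp add: H_prim_diff H_prim_const)

lemma vel_has_derivative:
  "z \<in> cper R \<Longrightarrow> (vel z has_real_derivative z t - H_prim z 1) (at t)"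
  unfolding vel_def by (rule zero_mean_prim_has_derivative[OF cperD(1)[OF cper_minus_mean]])

text \<open>Removing the mean doubles the bound, and so does the primitive of mean zero: 4 = 2 *
  2.\<close>

lemma vel_cper:
  assumes "z \<in> cper R"
  shows "vel z \<in> cper (4 * R)"
proof -
  note w = cperD[OF cper_minus_mean[OF assms]] and m = mean_minus_mean[OF assms]
  show ?thesis
    using continuous_zero_mean_prim[OF w(1)] zero_mean_prim_periodic[OF w(1,2) m] zero_mean_prim_bound[OF w(1,2) m w(3)]
    by (simp add: cper_def vel_def)
qed

lemma mean_vel: "z \<in> cper R \<Longrightarrow> H_prim (vel z) 1 = 0"
  unfolding vel_def by (rule mean_zero_mean_prim[OF cperD(1)[OF cper_minus_mean]])

lemma pos_has_derivative:
  "z \<in> cper R \<Longrightarrow> (pos z has_real_derivative vel z t) (at t)"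
  unfolding pos_def[abs_def]
  by (auto intro!: derivative_eq_intros zero_mean_prim_has_derivative cperD(1)[OF vel_cper])

text \<open>The constant is 9 = 2 * 4 + 1, from the primitive of \<open>vel z\<close> and the mean
  of \<open>z\<close>.\<close>

lemma pos_cper: 
  assumes "z \<in> cper R"
  shows "pos z \<in> cper (9 * R)"
proof -
  note V = cperD[OF vel_cper[OF assms]]
  have "\<bar>pos z t\<bar> \<le> 9 * R" for t
    using zero_mean_prim_bound[OF V(1,2) mean_vel[OF assms] V(3), of t] mean_bound[OF assms]
    unfolding pos_def by linarith
  moreover have "one_periodic (pos z)"
    using zero_mean_prim_periodic[OF V(1,2) mean_vel[OF assms]] by (simp add: one_periodic_def pos_def)
  ultimately show ?thesis
    using has_derivative_imp_continuous[OF pos_has_derivative[OF assms]] by (simp add: cper_def)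
qed

text \<open>The primitive part has mean zero, so only the added constant counts. The cancellation in
  \<open>T\<close> rests on this.\<close>

lemma mean_pos: "z \<in> cper R \<Longrightarrow> H_prim (pos z) 1 = H_prim z 1"
  unfolding pos_def[abs_def]
  by (subst H_prim_add) (auto simp: H_prim_const mean_zero_mean_prim cperD(1)[OF vel_cper] continuous_zero_mean_prim)

text \<open>Linearity turns the bounds 4 and 9 above into Lipschitz constants of \<open>vel\<close>
  and \<open>pos\<close>.\<close>

lemma vel_diff:
  assumes "u \<in> cper R" "v \<in> cper R"
  shows "vel (\<lambda>t. u t - v t) t = vel u t - vel v t"
proof -
  have "(\<lambda>t. u t - v t - H_prim (\<lambda>t. u t - v t) 1) = 
        (\<lambda>t. (u t - H_prim u 1) - (v t - H_prim v 1))"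
    using cperD(1)[OF assms(1)] cperD(1)[OF assms(2)] by (auto simp: H_prim_diff)
  then show ?thesis
    unfolding vel_def
    by (simp only: zero_mean_prim_diff[OF cperD(1)[OF cper_minus_mean[OF assms(1)]]
          cperD(1)[OF cper_minus_mean[OF assms(2)]]])
qed

lemma pos_diff:
  assumes "u \<in> cper R" "v \<in> cper R"
  shows "pos (\<lambda>t. u t - v t) t = pos u t - pos v t"
proof -
  have "vel (\<lambda>t. u t - v t) = (\<lambda>t. vel u t - vel v t)"
    using vel_diff[OF assms] by (rule ext)
  moreover have "zero_mean_prim (\<lambda>t. vel u t - vel v t) t = zero_mean_prim (vel u) t - zero_mean_prim (vel v) t"
    by (intro zero_mean_prim_diff cperD(1)[OF vel_cper[OF assms(1)]] cperD(1)[OF vel_cper[OF assms(2)]])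
  moreover have "H_prim (\<lambda>t. u t - v t) 1 = H_prim u 1 - H_prim v 1"
    by (intro H_prim_diff cperD(1)[OF assms(1)] cperD(1)[OF assms(2)])
  ultimately show ?thesis by (simp add: pos_def)
qed

subsection \<open>A contraction for periodic boundary value problems\<close>

text \<open>Banach's fixed-point theorem on the ball. \<open>contr\<close> speaks of an arbitrary
  pointwise bound \<open>D\<close> in place of the sup distance, which spares its users any
  suprema.\<close>

lemma cper_contraction:
  assumes "R \<ge> 0"
    and self: "\<And>u. u \<in> cper R \<Longrightarrow> T u \<in> cper R"
    and contr: "\<And>u v D t. \<lbrakk>u \<in> cper R; v \<in> cper R; \<And>t. \<bar>u t - v t\<bar> \<le> D\<rbrakk>
        \<Longrightarrow> \<bar>T u t - T v t\<bar> \<le> D / 2"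
  shows "\<exists>!u. u \<in> cper R \<and> T u = u"
proof -
  define S where "S = {u :: real \<Rightarrow>\<^sub>C real. apply_bcontfun u \<in> cper R}"
  have bcont: "apply_bcontfun (Bcontfun u) = u" if "u \<in> cper R" for u
    using that by (intro Bcontfun_inverse bcontfun_normI[of _ R]) (auto simp: cper_def)
  define T' where "T' u = Bcontfun (T (apply_bcontfun u))" for u
  have T': "apply_bcontfun (T' u) = T (apply_bcontfun u)" if "u \<in> S" for u
    using that self bcont by (auto simp: T'_def S_def)
  \<comment> \<open>Uniform limits are pointwise limits, and the bound and the periodicity are
    pointwise conditions that pass to the limit. Continuity is part of the type.\<close>
  have "closed S"
    unfolding closed_sequential_limits
  proof (intro allI impI, elim conjE)
    fix U u assume U: "\<forall>n. U n \<in> S" and lim: "U \<longlonglongrightarrow> u"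
    have pt: "(\<lambda>n. apply_bcontfun (U n) t) \<longlonglongrightarrow> apply_bcontfun u t" for t
      using tendsto_bcontfun_uniform_limit[OF lim] by (rule tendsto_uniform_limitI) simp
    have "\<bar>apply_bcontfun u t\<bar> \<le> R" for t
      by (rule tendsto_upperbound[OF tendsto_rabs[OF pt]])
         (use U in \<open>auto simp: S_def cper_def\<close>)
    moreover have "apply_bcontfun u (t + 1) = apply_bcontfun u t" for t
      by (rule LIMSEQ_unique[OF pt])
         (use U pt[of t] in \<open>simp add: S_def cper_def one_periodic_def\<close>)
    ultimately show "u \<in> S" by (simp add: S_def cper_def one_periodic_def)
  qed
  moreover have "0 \<in> S" using \<open>R \<ge> 0\<close> by (simp add: S_def cper_def one_periodic_def)
  moreover have "T' ` S \<subseteq> S" using T' self by (auto simp: S_def)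
  moreover have "dist (T' u) (T' v) \<le> 1 / 2 * dist u v" if "u \<in> S" "v \<in> S" for u v
  proof (rule dist_bound)
    fix t
    show "dist (apply_bcontfun (T' u) t) (apply_bcontfun (T' v) t) \<le> 1 / 2 * dist u v"
      using contr[of "apply_bcontfun u" "apply_bcontfun v" "dist u v" t] that T' dist_bounded[of u _ v]
      by (simp add: S_def dist_real_def)
  qed
  ultimately have "\<exists>!u. u \<in> S \<and> T' u = u"
    using Banach_fix[of S "1/2" T'] by (auto simp: complete_eq_closed)
  then obtain u where u: "u \<in> S" "T' u = u" and uniq: "\<And>v. v \<in> S \<Longrightarrow> T' v = v \<Longrightarrow> v = u"
    by blast
  show ?thesis
  proof (rule ex1I[of _ "apply_bcontfun u"])
    show "apply_bcontfun u \<in> cper R \<and> T (apply_bcontfun u) = apply_bcontfun u"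
      using u T'[of u] by (auto simp: S_def)
  next
    fix v assume v: "v \<in> cper R \<and> T v = v"
    then have "Bcontfun v = u" by (intro uniq) (auto simp: S_def T'_def bcont)
    then show "v = apply_bcontfun u" using bcont v by auto
  qed
qed

text \<open>\<open>N\<close> has slope \<open>k\<close> in \<open>x\<close> up to an error
  \<open>\<eta>\<close>, for arguments up to \<open>9 * R\<close>, a range that contains all values
  of \<open>pos\<close> and \<open>vel\<close> on \<open>cper R\<close>. Continuity is asked only
  along curves in that range, because the energy is controlled only there. The constants leave room
  for a contraction factor 1/2, and \<open>6 * B \<le> R\<close> makes the ball invariant.\<close>

locale averaging =
  fixes N :: "real \<Rightarrow> real \<Rightarrow> real \<Rightarrow> real" and k \<eta> B R :: real
  assumes k: "k \<noteq> 0" "\<bar>k\<bar> \<le> 1 / 100" and \<eta>: "0 \<le> \<eta>" "\<eta> \<le> \<bar>k\<bar> / 100"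
    and B: "0 \<le> B" "6 * B \<le> R"
    and continuous: "\<And>x y. \<lbrakk>continuous_on UNIV x; continuous_on UNIV y;
        \<And>t. \<bar>x t\<bar> \<le> 9 * R; \<And>t. \<bar>y t\<bar> \<le> 9 * R\<rbrakk> \<Longrightarrow> continuous_on UNIV (\<lambda>t. N t (x t) (y t))"
    and periodic: "\<And>t x y. N (t + 1) x y = N t x y"
    and increment: "\<And>t x\<^sub>1 x\<^sub>2 y\<^sub>1 y\<^sub>2.
        \<lbrakk>\<bar>x\<^sub>1\<bar> \<le> 9 * R; \<bar>x\<^sub>2\<bar> \<le> 9 * R; \<bar>y\<^sub>1\<bar> \<le> 9 * R; \<bar>y\<^sub>2\<bar> \<le> 9 * R\<rbrakk> \<Longrightarrow>
        \<bar>N t x\<^sub>1 y\<^sub>1 - N t x\<^sub>2 y\<^sub>2 - k * (x\<^sub>1 - x\<^sub>2)\<bar> \<le> \<eta> * (\<bar>x\<^sub>1 - x\<^sub>2\<bar> + \<bar>y\<^sub>1 - y\<^sub>2\<bar>)"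
    and base: "\<And>t. \<bar>N t 0 0\<bar> \<le> B" "\<bar>H_prim (\<lambda>t. N t 0 0) 1\<bar> \<le> B * \<bar>k\<bar>"
begin

definition force :: "(real \<Rightarrow> real) \<Rightarrow> real \<Rightarrow> real" where
  "force z t = N t (pos z t) (vel z t)"

definition T :: "(real \<Rightarrow> real) \<Rightarrow> real \<Rightarrow> real" where
  "T z t = force z t - H_prim (force z) 1 + (H_prim z 1 - H_prim (force z) 1 / k)"

definition periodic_sol :: "(real \<Rightarrow> real) \<Rightarrow> (real \<Rightarrow> real) \<Rightarrow> bool" where
  "periodic_sol x y \<longleftrightarrow> one_periodic x \<and> (\<forall>t. (x has_real_derivative y t) (at t)) \<and>
     (\<forall>t. (y has_real_derivative N t (x t) (y t)) (at t))"

lemma R_nonneg: "R \<ge> 0" using B by linarith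

text \<open>The radius \<open>r \<le> R\<close> stays free because existence uses the small ball of
  radius \<open>6 * B\<close> and uniqueness the full one.\<close>

lemma pos_vel_bounds:
  assumes "z \<in> cper r" "r \<le> R"
  shows "\<bar>pos z t\<bar> \<le> 9 * R" "\<bar>vel z t\<bar> \<le> 9 * R"
  using cperD(3)[OF pos_cper[OF assms(1)], of t] cperD(3)[OF vel_cper[OF assms(1)], of t] 
    assms(2) R_nonneg by linarith+

lemma force_continuous:
  assumes "z \<in> cper r" "r \<le> R"
  shows "continuous_on UNIV (force z)"
  unfolding force_def[abs_def]
  by (intro continuous cperD(1)[OF pos_cper[OF assms(1)]] cperD(1)[OF vel_cper[OF assms(1)]]
      pos_vel_bounds[OF assms])

lemma force_periodic: "z \<in> cper r \<Longrightarrow> one_periodic (force z)"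
  using cperD(2)[OF pos_cper[of z r]] cperD(2)[OF vel_cper[of z r]] periodic
  by (simp add: force_def one_periodic_def)

text \<open>The difference of the forces is \<open>k * pos z\<close> up to an error of order
  \<open>\<eta> * D\<close>, and is small since \<open>k\<close> and \<open>\<eta>\<close> are.
  Division by \<open>k\<close> would spoil this, but there the term \<open>k * H_prim z 1\<close>
  cancels against \<open>H_prim z 1\<close>. The three pieces add up to 1/10 + 1/10 + 13/100, which
  is below 1/2.\<close>

lemma T_contraction:
  assumes u: "u \<in> cper r" and v: "v \<in> cper r" and r: "r \<le> R" and D: "\<And>t. \<bar>u t - v t\<bar> \<le> D"
  shows "\<bar>T u t - T v t\<bar> \<le> D / 2"
proof -
  define z where "z = (\<lambda>t. u t - v t)"
  have z: "z \<in> cper D" unfolding z_def by (rule cper_diff[OF u v D])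
  have D0: "D \<ge> 0" using D[of 0] by linarith
  note cont = force_continuous[OF u r] force_continuous[OF v r]
  have cz: "continuous_on UNIV (pos z)" by (rule cperD(1)[OF pos_cper[OF z]])
  define \<Delta> where "\<Delta> = (\<lambda>t. force u t - force v t)"
  have c\<Delta>: "continuous_on UNIV \<Delta>" unfolding \<Delta>_def by (intro continuous_intros cont)
  have mz: "H_prim z 1 = H_prim u 1 - H_prim v 1"
    unfolding z_def using cperD(1)[OF u] cperD(1)[OF v] by (rule H_prim_diff)
  have m\<Delta>: "H_prim \<Delta> 1 = H_prim (force u) 1 - H_prim (force v) 1"
    unfolding \<Delta>_def using cont by (rule H_prim_diff)
  have px: "pos z s = pos u s - pos v s" "vel z s = vel u s - vel v s" for s
    unfolding z_def by (rule pos_diff[OF u v], rule vel_diff[OF u v])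
  \<comment> \<open>13 = 9 + 4, the bounds for \<open>pos z\<close> and
    \<open>vel z\<close>.\<close>
  have e: "\<bar>\<Delta> s - k * pos z s\<bar> \<le> 13 * \<eta> * D" for s
  proof -
    have "\<bar>\<Delta> s - k * pos z s\<bar> \<le> \<eta> * (\<bar>pos z s\<bar> + \<bar>vel z s\<bar>)"
      unfolding \<Delta>_def force_def px
      by (intro increment pos_vel_bounds[OF u r] pos_vel_bounds[OF v r])
    also have "\<dots> \<le> \<eta> * (9 * D + 4 * D)"
      by (intro mult_left_mono add_mono cperD(3)[OF pos_cper[OF z]] cperD(3)[OF vel_cper[OF z]] \<eta>)
    finally show ?thesis by (simp add: algebra_simps)
  qed
  have \<eta>': "13 * \<eta> * D \<le> 13 / 100 * \<bar>k\<bar> * D"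
    using mult_right_mono[OF \<eta>(2) D0] by (simp add: mult_ac)
  have kD: "\<bar>k\<bar> * D \<le> D / 100"
    using mult_right_mono[OF k(2) D0] by simp
  \<comment> \<open>The linear part gives 9/100, the error less than 1/100.\<close>
  have sup: "\<bar>\<Delta> s\<bar> \<le> 1 / 10 * D" for s
  proof -
    have "\<bar>k * pos z s\<bar> \<le> \<bar>k\<bar> * (9 * D)"
      unfolding abs_mult by (intro mult_left_mono cperD(3)[OF pos_cper[OF z]]) auto
    with e[of s] \<eta>' kD D0 show ?thesis by linarith
  qed
  then have m: "\<bar>H_prim \<Delta> 1\<bar> \<le> 1 / 10 * D"
    by (intro H_prim_bound c\<Delta>) auto
  have "\<bar>H_prim (\<lambda>s. \<Delta> s - k * pos z s) 1\<bar> \<le> 13 * \<eta> * D"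
    by (intro H_prim_bound e continuous_intros c\<Delta> cz) auto
  also have "H_prim (\<lambda>s. \<Delta> s - k * pos z s) 1 = H_prim \<Delta> 1 - k * H_prim z 1"
    by (simp add: H_prim_diff H_prim_cmult c\<Delta> cz continuous_on_mult_left mean_pos[OF z])
  also note \<eta>'
  finally have "\<bar>H_prim \<Delta> 1 - k * H_prim z 1\<bar> \<le> 13 / 100 * \<bar>k\<bar> * D" .
  \<comment> \<open>The cancellation: only the error in the mean gets divided by \<open>k\<close>,
    and its bound carries the factor \<open>\<bar>k\<bar>\<close>.\<close>
  moreover have "H_prim z 1 - H_prim \<Delta> 1 / k = - (H_prim \<Delta> 1 - k * H_prim z 1) / k"
    using k(1) by (simp add: field_simps)
  ultimately have "\<bar>H_prim z 1 - H_prim \<Delta> 1 / k\<bar> \<le> 13 / 100 * D"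
    using k(1) by (simp add: abs_divide pos_divide_le_eq mult_ac abs_minus_commute)
  moreover have "T u t - T v t = \<Delta> t - H_prim \<Delta> 1 + (H_prim z 1 - H_prim \<Delta> 1 / k)"
    unfolding T_def m\<Delta> mz unfolding \<Delta>_def by (simp add: diff_divide_distrib)
  ultimately show ?thesis using sup[of t] m D0 by linarith
qed

lemma zero_cper: "(\<lambda>_. 0) \<in> cper r" if "r \<ge> 0"
  using that by (auto simp: cper_def one_periodic_def)

text \<open>\<open>pos\<close> and \<open>vel\<close> vanish at zero, so the force is
  \<open>N t 0 0\<close>. Its value, its mean and its mean over \<open>k\<close> contribute
  \<open>B\<close> each, the last by the second half of \<open>base\<close>.\<close>

lemma T_zero: "\<bar>T (\<lambda>_. 0) t\<bar> \<le> 3 * B"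
proof -
  have "vel (\<lambda>_. 0) = (\<lambda>_. 0)"
    by (simp add: vel_def zero_mean_prim_def[abs_def] H_prim_const H_prim_const[abs_def])
  then have f: "force (\<lambda>_. 0) = (\<lambda>t. N t 0 0)"
    by (simp add: force_def[abs_def] pos_def[abs_def] zero_mean_prim_def H_prim_const H_prim_const[abs_def])
  have "\<bar>H_prim (\<lambda>t. N t 0 0) 1\<bar> \<le> B"
    using force_continuous[OF zero_cper order_refl] R_nonneg base(1)
    by (intro H_prim_bound) (auto simp: f)
  moreover have "\<bar>H_prim (\<lambda>t. N t 0 0) 1 / k\<bar> \<le> B"
    using base(2) k(1) by (simp add: abs_divide pos_divide_le_eq)
  ultimately show ?thesis
    using base(1)[of t] unfolding T_def f H_prim_const by linarith
qed

text \<open>The distance from \<open>T z\<close> to the image of zero is at most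
  \<open>r / 2\<close> by contraction, and that image is at most
  \<open>3 * B \<le> r / 2\<close>.\<close>

lemma T_cper:
  assumes z: "z \<in> cper r" and r: "6 * B \<le> r" "r \<le> R"
  shows "T z \<in> cper r"
proof -
  have r0: "r \<ge> 0" using r B by linarith
  have diff: "\<bar>T z t - T (\<lambda>_. 0) t\<bar> \<le> r / 2" for t
    by (rule T_contraction[OF z zero_cper[OF r0] r(2)]) (use cperD(3)[OF z] in simp)
  have "\<bar>T z t\<bar> \<le> r" for t
    using diff[of t] T_zero[of t] r(1) by linarith
  moreover have "continuous_on UNIV (T z)"
    unfolding T_def[abs_def] by (intro continuous_intros force_continuous[OF z r(2)]) (use k in auto)
  moreover have "one_periodic (T z)"
    using force_periodic[OF z] by (simp add: one_periodic_def T_def)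
  ultimately show ?thesis by (simp add: cper_def)
qed

lemma T_fixed_point:
  assumes "6 * B \<le> r" "r \<le> R"
  shows "\<exists>!z. z \<in> cper r \<and> T z = z"
  using assms B by (intro cper_contraction T_cper T_contraction) auto

text \<open>Once the mean of the force is zero, \<open>T z = z\<close> says that the force is
  \<open>z\<close> minus its mean, which is the derivative of \<open>vel z\<close>.\<close>

lemma fixed_point_imp_sol:
  assumes z: "z \<in> cper r" and r: "r \<le> R" and fp: "T z = z"
  shows "periodic_sol (pos z) (vel z)" "\<bar>N t (pos z t) (vel z t)\<bar> \<le> 2 * r"
proof -
  note c = force_continuous[OF z r]
  have "H_prim (T z) 1 = H_prim z 1 - H_prim (force z) 1 / k"
    using c by (simp add: T_def[abs_def] H_prim_add H_prim_diff H_prim_const continuous_on_diff)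
  then have m: "H_prim (force z) 1 = 0" using fp k(1) by simp
  then have f: "force z t = z t - H_prim z 1" for t
    using fun_cong[OF fp, of t] by (simp add: T_def)
  show "periodic_sol (pos z) (vel z)"
    unfolding periodic_sol_def
    using pos_has_derivative[OF z] vel_has_derivative[OF z] cperD(2)[OF pos_cper[OF z]] f
    by (simp add: force_def)
  show "\<bar>N t (pos z t) (vel z t)\<bar> \<le> 2 * r"
    using cperD(3)[OF cper_minus_mean[OF z], of t] f[of t] by (simp add: force_def)
qed

text \<open>Solving in the smallest admissible ball, of radius \<open>6 * B\<close>, gives bounds
  with 54 = 9 * 6 that do not depend on \<open>R\<close>.\<close>

lemma periodic_sol_exists:
  obtains x y where "periodic_sol x y" "\<And>t. \<bar>x t\<bar> \<le> 54 * B" "\<And>t. \<bar>y t\<bar> \<le> 54 * B"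
    "\<And>t. \<bar>N t (x t) (y t)\<bar> \<le> 54 * B"
proof -
  obtain z where z: "z \<in> cper (6 * B)" "T z = z"
    using T_fixed_point[of "6 * B"] B by blast
  note sol = fixed_point_imp_sol[OF z(1) B(2) z(2)]
  show ?thesis
  proof (rule that[OF sol(1)])
    fix t
    show "\<bar>pos z t\<bar> \<le> 54 * B" using cperD(3)[OF pos_cper[OF z(1)], of t] by simp
    show "\<bar>vel z t\<bar> \<le> 54 * B" using cperD(3)[OF vel_cper[OF z(1)], of t] B by linarith
    show "\<bar>N t (pos z t) (vel z t)\<bar> \<le> 54 * B" using sol(2)[of t] B by linarith
  qed
qed

text \<open>The converse passage, needed for uniqueness. The bounds are \<open>R / 2\<close> because
  \<open>z\<close> is the sum of the acceleration and the mean position, and must stay in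
  \<open>cper R\<close>.\<close>

lemma sol_imp_fixed_point:
  assumes sol: "periodic_sol x y"
    and bd: "\<And>t. \<bar>x t\<bar> \<le> R / 2" "\<And>t. \<bar>y t\<bar> \<le> R / 2" "\<And>t. \<bar>N t (x t) (y t)\<bar> \<le> R / 2"
  defines "z \<equiv> \<lambda>t. N t (x t) (y t) + H_prim x 1"
  shows "z \<in> cper R" "T z = z" "pos z = x"
proof -
  have x': "(x has_real_derivative y t) (at t)"
    and y': "(y has_real_derivative N t (x t) (y t)) (at t)" and px: "one_periodic x" for t
    using sol by (auto simp: periodic_sol_def)
  have cx: "continuous_on UNIV x" and cy: "continuous_on UNIV y"
    by (rule has_derivative_imp_continuous[OF x'], rule has_derivative_imp_continuous[OF y'])
  have py: "one_periodic y" by (rule one_periodic_derivative[OF px x'])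
  define w where "w = (\<lambda>t. N t (x t) (y t))"
  have bd9: "\<bar>x t\<bar> \<le> 9 * R" "\<bar>y t\<bar> \<le> 9 * R" for t
    using bd(1)[of t] bd(2)[of t] R_nonneg by linarith+
  have cw: "continuous_on UNIV w" unfolding w_def by (intro continuous cx cy bd9)
  have pw: "one_periodic w"
    using px py periodic by (auto simp: one_periodic_def w_def)
  have mx: "\<bar>H_prim x 1\<bar> \<le> R / 2" by (rule H_prim_bound[OF cx bd(1)]) auto
  have "\<bar>z t\<bar> \<le> R" for t using bd(3)[of t] mx unfolding z_def by linarith
  moreover have "continuous_on UNIV z" using cw by (auto simp: z_def w_def intro!: continuous_intros)
  ultimately show z: "z \<in> cper R" using pw by (simp add: cper_def z_def w_def one_periodic_def)
  \<comment> \<open>The derivative of a periodic function has mean zero; this is applied to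
    \<open>y\<close> here and to \<open>x\<close> next.\<close>
  have mw: "H_prim w 1 = 0"
    using H_prim_eqI[OF cw, of y 1] y' py[unfolded one_periodic_def, rule_format, of 0]
    by (simp add: w_def)
  have my: "H_prim y 1 = 0"
    using H_prim_eqI[OF cy x', of 1] px[unfolded one_periodic_def, rule_format, of 0] by simp
  have mz: "H_prim z 1 = H_prim x 1"
    using mw cw by (simp add: z_def w_def H_prim_add H_prim_const)
  have "vel z = y"
    unfolding vel_def mz
    using zero_mean_prim_eqI[of "\<lambda>t. N t (x t) (y t)" y] cw y' my by (simp add: z_def w_def)
  moreover have "zero_mean_prim y = (\<lambda>t. x t - H_prim x 1)"
    by (rule zero_mean_prim_eqI[OF cy])
       (auto intro!: derivative_eq_intros x' simp: H_prim_diff H_prim_const cx)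
  ultimately show "pos z = x" by (simp add: pos_def[abs_def] mz)
  with \<open>vel z = y\<close> have "force z = w" by (simp add: force_def[abs_def] w_def)
  then show "T z = z" by (simp add: T_def[abs_def] mw mz) (simp add: w_def z_def)
qed

text \<open>Both solutions yield the one fixed point in \<open>cper R\<close>, and
  \<open>pos\<close> recovers the solution from it.\<close>

lemma periodic_sol_unique:
  assumes "periodic_sol x y" "\<And>t. \<bar>x t\<bar> \<le> R / 2" "\<And>t. \<bar>y t\<bar> \<le> R / 2"
      "\<And>t. \<bar>N t (x t) (y t)\<bar> \<le> R / 2"
    and "periodic_sol x' y'" "\<And>t. \<bar>x' t\<bar> \<le> R / 2" "\<And>t. \<bar>y' t\<bar> \<le> R / 2"
      "\<And>t. \<bar>N t (x' t) (y' t)\<bar> \<le> R / 2"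
  shows "x = x'"
  using sol_imp_fixed_point[OF assms(1-4)] sol_imp_fixed_point[OF assms(5-8)]
    T_fixed_point[OF B(2) order_refl] by metis

end

subsection \<open>Differentiability\<close>

lemma Ck_on_Suc_real:
  assumes "Ck_on (Suc n) g S" "x \<in> S"
  shows "(g has_real_derivative deriv g x) (at x)"
  using assms DERIV_deriv_iff_real_differentiable by auto

lemma frechet_derivative_real:
  assumes "(g has_real_derivative D) (at x)"
  shows "frechet_derivative g (at x) v = v * D"
proof -
  have "frechet_derivative g (at x) = (*) D"
    using assms frechet_derivative_at[of g "(*) D" x] by (simp add: has_field_derivative_def)
  then show ?thesis by simp
qed

lemma Ck_on_1_deriv_continuous:
  fixes g :: "real \<Rightarrow> real"
  assumes "Ck_on 1 g S"
  shows "continuous_on S (deriv g)"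
proof -
  have "continuous_on S (\<lambda>x. frechet_derivative g (at x) 1)"
    using assms by (simp add: One_nat_def)
  then show ?thesis
    by (rule continuous_on_eq)
       (use frechet_derivative_real[OF Ck_on_Suc_real[of 0]] assms in \<open>simp add: One_nat_def\<close>)
qed

lemma Ck_on_Suc_imp_continuous_on: "Ck_on (Suc n) g S \<Longrightarrow> continuous_on S g"
  by (auto intro!: continuous_at_imp_continuous_on differentiable_imp_continuous_within)

lemma Ck_on_2_imp_1: "Ck_on 2 g S \<Longrightarrow> Ck_on 1 g S"
  unfolding numeral_2_eq_2 One_nat_def
  using Ck_on_Suc_imp_continuous_on Ck_on.simps by metis

text \<open>In one variable the derivative in direction \<open>v\<close> is \<open>v\<close> times
  the ordinary one: direction 1 gives the forward implication, scaling by \<open>v\<close> the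
  other.\<close>

lemma Ck_on_2_real_iff:
  fixes g :: "real \<Rightarrow> real"
  shows "Ck_on 2 g UNIV \<longleftrightarrow> (\<exists>g' g''. (\<forall>t. (g has_real_derivative g' t) (at t)) \<and>
    (\<forall>t. (g' has_real_derivative g'' t) (at t)) \<and> continuous_on UNIV g'')" (is "_ \<longleftrightarrow> ?R")
proof
  assume L: "Ck_on 2 g UNIV"
  have d: "(g has_real_derivative deriv g t) (at t)" for t
    using L Ck_on_Suc_real[of 1 g UNIV t] by (simp add: numeral_2_eq_2)
  have "Ck_on 1 (\<lambda>x. frechet_derivative g (at x) 1) UNIV"
    using L by (simp add: numeral_2_eq_2)
  then have d1: "Ck_on 1 (deriv g) UNIV" by (simp add: frechet_derivative_real[OF d])
  show ?R
    using d Ck_on_1_deriv_continuous[OF d1] Ck_on_Suc_real[of 0 "deriv g" UNIV] d1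
    unfolding One_nat_def by blast
next
  assume ?R
  then obtain g' g'' where d: "(g has_real_derivative g' t) (at t)"
     "(g' has_real_derivative g'' t) (at t)" and c: "continuous_on UNIV g''" for t by blast
  have dv: "((\<lambda>t. v * g' t) has_real_derivative v * g'' t) (at t)" for v t
    by (rule DERIV_cmult[OF d(2)])
  have "\<exists>D. ((\<lambda>t. v * g' t) has_real_derivative D) (at t)" for v t
    using dv by blast
  then show "Ck_on 2 g UNIV"
    using d c
    by (auto simp: numeral_2_eq_2 frechet_derivative_real[OF d(1)] frechet_derivative_real[OF dv]
        real_differentiable_def intro!: continuous_intros)
qed

text \<open>The partial derivatives are the Frechet derivative in the coordinate directions, whose
  continuity is part of \<open>Ck_on 1\<close>.\<close>

lemma partial_derivatives:
  fixes f :: "real \<times> real \<Rightarrow> real"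
  assumes "Ck_on 1 f UNIV"
  obtains f\<^sub>1 f\<^sub>2 where
    "\<And>s e. ((\<lambda>s. f (s, e)) has_real_derivative f\<^sub>1 (s, e)) (at s)"
    "\<And>s e. ((\<lambda>e. f (s, e)) has_real_derivative f\<^sub>2 (s, e)) (at e)"
    "continuous_on UNIV f\<^sub>1" "continuous_on UNIV f\<^sub>2"
proof -
  let ?D = "\<lambda>p. frechet_derivative f (at p)"
  have D: "(f has_derivative ?D p) (at p)" for p
  proof (rule frechet_derivative_works[THEN iffD1])
    show "f differentiable at p" using assms unfolding One_nat_def Ck_on.simps by blast
  qed
  have lin: "linear (?D p)" for p using D has_derivative_linear by blast
  show ?thesis
  proof (rule that[of "\<lambda>p. ?D p (1, 0)" "\<lambda>p. ?D p (0, 1)"])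
    fix s e
    have "((\<lambda>s. f (s, e)) has_derivative (\<lambda>h. ?D (s, e) (h, 0))) (at s)"
      by (rule has_derivative_compose[OF _ D]) (auto intro!: derivative_eq_intros)
    moreover have "?D (s, e) (h, 0) = ?D (s, e) (1, 0) * h" for h
      using linear_scale[OF lin, of "(s, e)" h "(1, 0)"] by simp
    then have "(\<lambda>h. ?D (s, e) (h, 0)) = (*) (?D (s, e) (1, 0))" by (rule ext)
    ultimately show "((\<lambda>s. f (s, e)) has_real_derivative ?D (s, e) (1, 0)) (at s)"
      by (simp only: has_field_derivative_def)
    have "((\<lambda>e. f (s, e)) has_derivative (\<lambda>h. ?D (s, e) (0, h))) (at e)"
      by (rule has_derivative_compose[OF _ D]) (auto intro!: derivative_eq_intros)
    moreover have "?D (s, e) (0, h) = ?D (s, e) (0, 1) * h" for h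
      using linear_scale[OF lin, of "(s, e)" h "(0, 1)"] by simp
    then have "(\<lambda>h. ?D (s, e) (0, h)) = (*) (?D (s, e) (0, 1))" by (rule ext)
    ultimately show "((\<lambda>e. f (s, e)) has_real_derivative ?D (s, e) (0, 1)) (at e)"
      by (simp only: has_field_derivative_def)
  qed (use assms in \<open>auto simp: One_nat_def\<close>)
qed

text \<open>A continuous derivative is bounded on a compact ball inside the open set, and the mean
  value inequality applies on this convex ball.\<close>

lemma locally_Lipschitz:
  fixes K :: "real \<Rightarrow> real"
  assumes "open J" "p \<in> J" "\<And>z. z \<in> J \<Longrightarrow> (K has_real_derivative K' z) (at z)"
    and "continuous_on J K'"
  obtains r L where "r > 0" "L \<ge> 0" "cball p r \<subseteq> J" "L-lipschitz_on (cball p r) K"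
proof -
  obtain r where r: "r > 0" "cball p r \<subseteq> J" using assms(1,2) open_contains_cball by blast
  have "compact (K' ` cball p r)"
    by (intro compact_continuous_image continuous_on_subset[OF assms(4) r(2)] compact_cball)
  then obtain L where L: "\<And>z. z \<in> cball p r \<Longrightarrow> \<bar>K' z\<bar> \<le> L"
    using compact_imp_bounded[THEN bounded_iff[THEN iffD1]] by fastforce
  have L0: "L \<ge> 0" using L[of p] r(1) by (intro order_trans[OF abs_ge_zero]) auto
  have der: "(K has_real_derivative K' z) (at z within cball p r)" if "z \<in> cball p r" for z
    using assms(3) r(2) that has_field_derivative_at_within by blast
  have "norm (K x - K y) \<le> L * norm (x - y)" if "x \<in> cball p r" "y \<in> cball p r" for x y
    by (rule field_differentiable_bound[where S = "cball p r" and f' = K'])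
       (use L that in \<open>auto intro!: der\<close>)
  then have "L-lipschitz_on (cball p r) K"
    using L0 by (intro lipschitz_onI) (auto simp: dist_norm)
  then show ?thesis using that r L0 by blast
qed

text \<open>The common form of the upper bounds imposed on \<open>e\<close> below.\<close>

lemma eventually_mult_le:
  fixes c p :: real
  assumes "p > 0"
  shows "\<forall>\<^sub>F e in at_right 0. e * c \<le> p"
proof -
  have "((\<lambda>e. e * c) \<longlongrightarrow> 0 * c) (at_right 0)" by (intro tendsto_intros)
  then have "\<forall>\<^sub>F e in at_right 0. e * c < p" using assms by (intro order_tendstoD(2)) auto
  then show ?thesis by eventually_elim simp
qed

subsection \<open>The rescaled equation\<close>

definition rescaled_energy :: "(real \<times> real \<Rightarrow> real) \<Rightarrow> real \<Rightarrow> real \<Rightarrow> real \<Rightarrow> real \<Rightarrow> real \<Rightarrow> real" where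
  "rescaled_energy f d a e x y = (e * y)\<^sup>2 / 2 - e * F_prim f (a + e * x) e - d"

text \<open>With \<open>\<psi> = a + e * x\<close> one has \<open>\<psi>'' = e * x''\<close>, so the
  factor \<open>e\<close> of the original right-hand side has cancelled. \<open>y\<close> stands for
  \<open>x'\<close>, and \<open>K\<close> for \<open>h\<close> composed with the inverse of
  \<open>H_prim h\<close>.\<close>

definition rescaled_rhs ::
  "(real \<times> real \<Rightarrow> real) \<Rightarrow> (real \<Rightarrow> real) \<Rightarrow> (real \<Rightarrow> real) \<Rightarrow> real \<Rightarrow> real \<Rightarrow> real \<Rightarrow>
    real \<Rightarrow> real \<Rightarrow> real \<Rightarrow> real" where
  "rescaled_rhs f K \<gamma> d a e t x y = f (a + e * x, e) + \<gamma> t * K (rescaled_energy f d a e x y)"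

text \<open>Energies at bounded arguments differ only by terms of order \<open>e * e\<close>, so
  \<open>K\<close> contributes to higher order and the slope \<open>e * f\<^sub>1 (a, 0)\<close>
  comes from \<open>f\<close> alone. \<open>B\<close> is obtained before \<open>R\<close>, so that
  one \<open>B\<close> serves all radii.\<close>

lemma rescaled_averaging:
  fixes f f\<^sub>1 f\<^sub>2 :: "real \<times> real \<Rightarrow> real" and K \<gamma> :: "real \<Rightarrow> real" and a d L r :: real
  assumes f: "continuous_on UNIV f"
    and f\<^sub>1: "\<And>s e. ((\<lambda>s. f (s, e)) has_real_derivative f\<^sub>1 (s, e)) (at s)" "continuous_on UNIV f\<^sub>1"
    and f\<^sub>2: "\<And>s e. ((\<lambda>e. f (s, e)) has_real_derivative f\<^sub>2 (s, e)) (at e)" "continuous_on UNIV f\<^sub>2"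
    and K: "r > 0" "L \<ge> 0" "L-lipschitz_on (cball (-d) r) K"
    and \<gamma>: "continuous_on UNIV \<gamma>" "one_periodic \<gamma>"
    and zero: "f (a, 0) + K (-d) * H_prim \<gamma> 1 = 0"
    and simple: "f\<^sub>1 (a, 0) \<noteq> 0"
  obtains B where "B \<ge> 0" "\<And>R. 6 * B \<le> R \<Longrightarrow> \<forall>\<^sub>F e in at_right 0.
     averaging (rescaled_rhs f K \<gamma> d a e) (e * f\<^sub>1 (a, 0)) (e * \<bar>f\<^sub>1 (a, 0)\<bar> / 100) B R \<and>
     (\<forall>x y. \<bar>x\<bar> \<le> 9 * R \<longrightarrow> \<bar>y\<bar> \<le> 9 * R \<longrightarrow> rescaled_energy f d a e x y \<in> cball (-d) r)"
proof -
  define m where "m = f\<^sub>1 (a, 0)"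
  obtain \<Gamma> where \<Gamma>: "\<Gamma> \<ge> 0" "\<And>t. \<bar>\<gamma> t\<bar> \<le> \<Gamma>" using one_periodic_bounded[OF \<gamma>] by blast
  \<comment> \<open>Large enough for the points \<open>(a + e * x, e)\<close> with
    \<open>e \<le> 1\<close> and \<open>\<bar>e * x\<bar> \<le> 1\<close>, and for the segments from
    first coordinate 0 over which \<open>F_prim\<close> integrates.\<close>
  define box where "box = {-(\<bar>a\<bar> + 1)..\<bar>a\<bar> + 1} \<times> {0..1::real}"
  have box: "compact box" unfolding box_def by (intro compact_Times compact_Icc)
  have bounded_box: "\<exists>c\<ge>0. \<forall>p\<in>box. \<bar>g p\<bar> \<le> c" if "continuous_on UNIV g" for g :: "real \<times> real \<Rightarrow> real"
  proof -
    have "compact (g ` box)" using that box by (intro compact_continuous_image continuous_on_subset[OF that]) auto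
    then obtain c where "\<forall>p\<in>box. \<bar>g p\<bar> \<le> c"
      using compact_imp_bounded[THEN bounded_iff[THEN iffD1]] by fastforce
    moreover have "(0, 0) \<in> box" by (auto simp: box_def)
    ultimately show ?thesis by (intro exI[of _ c]) (auto intro: order_trans[OF abs_ge_zero])
  qed
  obtain \<Phi> where \<Phi>: "\<Phi> \<ge> 0" "\<And>p. p \<in> box \<Longrightarrow> \<bar>f p\<bar> \<le> \<Phi>" using bounded_box[OF f] by blast
  obtain L\<^sub>2 where L\<^sub>2: "L\<^sub>2 \<ge> 0" "\<And>p. p \<in> box \<Longrightarrow> \<bar>f\<^sub>2 p\<bar> \<le> L\<^sub>2" using bounded_box[OF f\<^sub>2(2)] by blast
  define \<Psi> where "\<Psi> = \<Phi> * (\<bar>a\<bar> + 1)"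
  have \<Psi>: "\<Psi> \<ge> 0" using \<Phi>(1) by (simp add: \<Psi>_def)
  have F_eq: "F_prim f s e = H_prim (\<lambda>u. f (u, e)) s" for s e by (simp add: F_prim_def H_prim_def)
  have fc: "continuous_on UNIV (\<lambda>u. f (u, e))" for e
    by (rule has_derivative_imp_continuous[OF f\<^sub>1(1)])
  have F_lip: "\<bar>F_prim f s e - F_prim f s' e\<bar> \<le> \<Phi> * \<bar>s - s'\<bar>"
    if "(s, e) \<in> box" "(s', e) \<in> box" for s s' e
    unfolding F_eq
  proof (rule H_prim_Lipschitz[OF fc])
    fix u assume "u \<in> closed_segment s' s"
    then show "\<bar>f (u, e)\<bar> \<le> \<Phi>"
      using that by (intro \<Phi>) (auto simp: box_def closed_segment_eq_real_ivl split: if_splits)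
  qed
  have F_bd: "\<bar>F_prim f s e\<bar> \<le> \<Psi>" if "(s, e) \<in> box" for s e
  proof -
    have "\<bar>F_prim f s e - F_prim f 0 e\<bar> \<le> \<Phi> * \<bar>s - 0\<bar>"
      using that by (intro F_lip) (auto simp: box_def)
    also have "\<dots> \<le> \<Psi>" unfolding \<Psi>_def using that \<Phi>(1) by (intro mult_left_mono) (auto simp: box_def)
    finally show ?thesis by (simp add: F_eq)
  qed
  \<comment> \<open>\<open>e * A\<close> will bound the distance of \<open>N t 0 0\<close> from its
    limit as \<open>e\<close> tends to 0: \<open>L\<^sub>2\<close> accounts for the second argument
    of \<open>f\<close>, the other term for the energy.\<close>
  define A where "A = L\<^sub>2 + \<Gamma> * L * \<Psi>"
  have A0: "A \<ge> 0" unfolding A_def using L\<^sub>2(1) \<Gamma>(1) K(2) \<Psi> by simp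
  \<comment> \<open>The first three terms bound \<open>N t 0 0\<close>. The last serves the mean:
    \<open>e * A\<close> equals \<open>A / \<bar>m\<bar>\<close> times
    \<open>\<bar>e * m\<bar>\<close>.\<close>
  define B where "B = \<bar>f (a, 0)\<bar> + \<Gamma> * \<bar>K (-d)\<bar> + A + A / \<bar>m\<bar>"
  have B0: "B \<ge> 0" unfolding B_def using \<Gamma>(1) A0 by simp
  show ?thesis
  proof (rule that[OF B0])
    fix R assume R: "6 * B \<le> R"
    define Q where "Q = 9 * R"
    have Q0: "Q \<ge> 0" using R B0 by (simp add: Q_def)
    have m0: "\<bar>m\<bar> > 0" using simple by (simp add: m_def)
    have "isCont f\<^sub>1 (a, 0)" using f\<^sub>1(2) by (simp add: continuous_on_eq_continuous_at)
    then obtain \<rho> where \<rho>: "\<rho> > 0" "\<And>p. dist p (a, 0) < \<rho> \<Longrightarrow> \<bar>f\<^sub>1 p - m\<bar> < \<bar>m\<bar> / 200"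
      using m0 unfolding continuous_at_eps_delta m_def dist_real_def
      by (metis divide_pos_pos zero_less_numeral)
    have "\<forall>\<^sub>F e in at_right (0::real). 0 < e" by (rule eventually_at_right_less)
    moreover have "\<forall>\<^sub>F e in at_right 0. e * 1 \<le> (1::real)" by (rule eventually_mult_le) simp
    moreover have "\<forall>\<^sub>F e in at_right 0. e * 1 \<le> \<rho> / 4" by (rule eventually_mult_le) (use \<rho> in simp)
    moreover have "\<forall>\<^sub>F e in at_right 0. e * Q \<le> \<rho> / 4" by (rule eventually_mult_le) (use \<rho> in simp)
    moreover have "\<forall>\<^sub>F e in at_right 0. e * Q \<le> 1" by (rule eventually_mult_le) simp
    moreover have "\<forall>\<^sub>F e in at_right 0. e * (Q + \<Psi>) \<le> r" by (rule eventually_mult_le) (use K in simp)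
    moreover have "\<forall>\<^sub>F e in at_right 0. e * (\<Gamma> * L * (Q + \<Phi>)) \<le> \<bar>m\<bar> / 200"
      by (rule eventually_mult_le) (use m0 in simp)
    moreover have "\<forall>\<^sub>F e in at_right 0. e * \<bar>m\<bar> \<le> 1 / 100" by (rule eventually_mult_le) simp
    ultimately show "\<forall>\<^sub>F e in at_right 0.
      averaging (rescaled_rhs f K \<gamma> d a e) (e * f\<^sub>1 (a, 0)) (e * \<bar>f\<^sub>1 (a, 0)\<bar> / 100) B R \<and>
     (\<forall>x y. \<bar>x\<bar> \<le> 9 * R \<longrightarrow> \<bar>y\<bar> \<le> 9 * R \<longrightarrow> rescaled_energy f d a e x y \<in> cball (-d) r)"
      unfolding m_def[symmetric] Q_def[symmetric]
    proof eventually_elim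
      \<comment> \<open>In turn the conditions keep \<open>f\<close> evaluated near
        \<open>(a, 0)\<close> and in \<open>box\<close>, the energy in the ball where
        \<open>K\<close> is Lipschitz, the increment of the \<open>K\<close> term below half of the
        allowed error, and the slope below 1/100.\<close>
      fix e :: real
      assume e: "0 < e" "e * 1 \<le> 1" "e * 1 \<le> \<rho> / 4" "e * Q \<le> \<rho> / 4" "e * Q \<le> 1" "e * (Q + \<Psi>) \<le> r"
        "e * (\<Gamma> * L * (Q + \<Phi>)) \<le> \<bar>m\<bar> / 200" "e * \<bar>m\<bar> \<le> 1 / 100"
      let ?E = "rescaled_energy f d a e" and ?N = "rescaled_rhs f K \<gamma> d a e"
      have ex: "\<bar>e * x\<bar> \<le> e * Q" if "\<bar>x\<bar> \<le> Q" for x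
        using that e(1) by (simp add: abs_mult)
      have in_box: "(a + e * x, e) \<in> box" if "\<bar>x\<bar> \<le> Q" for x
        using ex[OF that] e(1,2,5) by (simp add: box_def) linarith
      have F1: "\<bar>F_prim f (a + e * x) e\<bar> \<le> \<Psi>" if "\<bar>x\<bar> \<le> Q" for x
        by (rule F_bd[OF in_box[OF that]])
      \<comment> \<open>As \<open>e * Q \<le> 1\<close>, the squared velocity is at most
        \<open>e * Q\<close>, so the energy is within \<open>e * (Q + \<Psi>) \<le> r\<close> of
        \<open>-d\<close>.\<close>
      have E: "?E x y \<in> cball (-d) r" if "\<bar>x\<bar> \<le> Q" "\<bar>y\<bar> \<le> Q" for x y
      proof -
        have "(e * y)\<^sup>2 \<le> (e * Q)\<^sup>2" using ex[OF that(2)] by (simp add: power2_le_iff_abs_le Q0 e(1) less_imp_le)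
        also have "\<dots> \<le> e * Q * 1" unfolding power2_eq_square
          using e(1,5) Q0 by (intro mult_left_mono) auto
        finally have "(e * y)\<^sup>2 / 2 \<le> e * Q" using zero_le_power2[of "e * y"] by linarith
        moreover have "0 \<le> (e * y)\<^sup>2 / 2" by simp
        moreover have "\<bar>e * F_prim f (a + e * x) e\<bar> \<le> e * \<Psi>"
          using F1[OF that(1)] e(1) by (simp add: abs_mult)
        ultimately have "\<bar>?E x y + d\<bar> \<le> e * (Q + \<Psi>)"
          unfolding rescaled_energy_def distrib_left by linarith
        with e(6) have "\<bar>?E x y + d\<bar> \<le> r" by linarith
        then show ?thesis by (simp add: dist_real_def abs_minus_commute)
      qed
      \<comment> \<open>Both parts carry \<open>e * e\<close>: the kinetic one through the factored
        difference of squares, the potential one through the outer \<open>e\<close> and the inner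
        argument \<open>a + e * x\<close>.\<close>
      have E_diff: "\<bar>?E x\<^sub>1 y\<^sub>1 - ?E x\<^sub>2 y\<^sub>2\<bar> \<le> e * e * (Q + \<Phi>) * (\<bar>x\<^sub>1 - x\<^sub>2\<bar> + \<bar>y\<^sub>1 - y\<^sub>2\<bar>)"
        if x: "\<bar>x\<^sub>1\<bar> \<le> Q" "\<bar>x\<^sub>2\<bar> \<le> Q" and y: "\<bar>y\<^sub>1\<bar> \<le> Q" "\<bar>y\<^sub>2\<bar> \<le> Q" for x\<^sub>1 x\<^sub>2 y\<^sub>1 y\<^sub>2
      proof -
        let ?dF = "F_prim f (a + e * x\<^sub>1) e - F_prim f (a + e * x\<^sub>2) e"
        have "\<bar>?dF\<bar> \<le> \<Phi> * \<bar>(a + e * x\<^sub>1) - (a + e * x\<^sub>2)\<bar>"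
          by (intro F_lip in_box x)
        also have "(a + e * x\<^sub>1) - (a + e * x\<^sub>2) = e * (x\<^sub>1 - x\<^sub>2)" by (simp add: algebra_simps)
        finally have "e * \<bar>?dF\<bar> \<le> e * (\<Phi> * \<bar>e * (x\<^sub>1 - x\<^sub>2)\<bar>)"
          using e(1) by (intro mult_left_mono) auto
        then have dF: "\<bar>e * ?dF\<bar> \<le> e * e * (\<Phi> * \<bar>x\<^sub>1 - x\<^sub>2\<bar>)"
          using e(1) by (simp add: abs_mult mult_ac)
        have "\<bar>(y\<^sub>1 + y\<^sub>2) / 2\<bar> \<le> Q" using y by (auto simp: abs_le_iff)
        then have "\<bar>(y\<^sub>1 + y\<^sub>2) / 2\<bar> * \<bar>y\<^sub>1 - y\<^sub>2\<bar> \<le> Q * \<bar>y\<^sub>1 - y\<^sub>2\<bar>"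
          by (rule mult_right_mono) simp
        then have "e * e * \<bar>(y\<^sub>1 + y\<^sub>2) / 2 * (y\<^sub>1 - y\<^sub>2)\<bar> \<le> e * e * (Q * \<bar>y\<^sub>1 - y\<^sub>2\<bar>)"
          unfolding abs_mult by (rule mult_left_mono) simp
        then have dy: "\<bar>e * e * ((y\<^sub>1 + y\<^sub>2) / 2 * (y\<^sub>1 - y\<^sub>2))\<bar> \<le> e * e * (Q * \<bar>y\<^sub>1 - y\<^sub>2\<bar>)"
          by (simp add: abs_mult)
        have "?E x\<^sub>1 y\<^sub>1 - ?E x\<^sub>2 y\<^sub>2 = e * e * ((y\<^sub>1 + y\<^sub>2) / 2 * (y\<^sub>1 - y\<^sub>2)) - e * ?dF"
          by (simp add: rescaled_energy_def field_simps power2_eq_square)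
        then have "\<bar>?E x\<^sub>1 y\<^sub>1 - ?E x\<^sub>2 y\<^sub>2\<bar> \<le> e * e * (Q * \<bar>y\<^sub>1 - y\<^sub>2\<bar>) + e * e * (\<Phi> * \<bar>x\<^sub>1 - x\<^sub>2\<bar>)"
          using dy dF by linarith
        also have "\<dots> = e * e * (Q * \<bar>y\<^sub>1 - y\<^sub>2\<bar> + \<Phi> * \<bar>x\<^sub>1 - x\<^sub>2\<bar>)" by (simp add: distrib_left)
        also have "\<dots> \<le> e * e * ((Q + \<Phi>) * (\<bar>x\<^sub>1 - x\<^sub>2\<bar> + \<bar>y\<^sub>1 - y\<^sub>2\<bar>))"
        proof (rule mult_left_mono)
          show "Q * \<bar>y\<^sub>1 - y\<^sub>2\<bar> + \<Phi> * \<bar>x\<^sub>1 - x\<^sub>2\<bar> \<le> (Q + \<Phi>) * (\<bar>x\<^sub>1 - x\<^sub>2\<bar> + \<bar>y\<^sub>1 - y\<^sub>2\<bar>)"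
            using mult_nonneg_nonneg[OF Q0 abs_ge_zero[of "x\<^sub>1 - x\<^sub>2"]]
              mult_nonneg_nonneg[OF \<Phi>(1) abs_ge_zero[of "y\<^sub>1 - y\<^sub>2"]]
            unfolding distrib_left distrib_right by linarith
        qed simp
        finally show ?thesis by (simp add: mult.assoc)
      qed
      have K_lip: "\<bar>\<gamma> t * (K u - K v)\<bar> \<le> \<Gamma> * L * \<bar>u - v\<bar>"
        if "u \<in> cball (-d) r" "v \<in> cball (-d) r" for t u v
      proof -
        have "\<bar>K u - K v\<bar> \<le> L * \<bar>u - v\<bar>"
          using lipschitz_onD[OF K(3) that] by (simp add: dist_real_def)
        then show ?thesis
          unfolding abs_mult mult.assoc by (intro mult_mono \<Gamma>) (use \<Gamma>(1) in auto)
      qed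
      \<comment> \<open>The mean value inequality for \<open>f (s, e) - m * s\<close>, whose
        derivative in \<open>s\<close> is small near \<open>(a, 0)\<close>. It takes one half of the
        allowed error, the \<open>K\<close> term the other.\<close>
      have f_incr: "\<bar>f (a + e * x\<^sub>1, e) - f (a + e * x\<^sub>2, e) - e * m * (x\<^sub>1 - x\<^sub>2)\<bar> \<le> \<bar>m\<bar> / 200 * (e * \<bar>x\<^sub>1 - x\<^sub>2\<bar>)"
        if x: "\<bar>x\<^sub>1\<bar> \<le> Q" "\<bar>x\<^sub>2\<bar> \<le> Q" for x\<^sub>1 x\<^sub>2
      proof -
        let ?S = "cball a (\<rho> / 4)"
        have "norm ((f (a + e * x\<^sub>1, e) - m * (a + e * x\<^sub>1)) - (f (a + e * x\<^sub>2, e) - m * (a + e * x\<^sub>2)))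
          \<le> \<bar>m\<bar> / 200 * norm ((a + e * x\<^sub>1) - (a + e * x\<^sub>2))"
        proof (rule field_differentiable_bound[where S = ?S and f' = "\<lambda>s. f\<^sub>1 (s, e) - m"])
          fix s assume s: "s \<in> ?S"
          show "((\<lambda>s. f (s, e) - m * s) has_field_derivative f\<^sub>1 (s, e) - m) (at s within ?S)"
            by (rule has_field_derivative_at_within) (auto intro!: derivative_eq_intros f\<^sub>1(1))
          have "dist (s, e) (a, 0) \<le> dist s a + dist e 0"
            unfolding dist_Pair_Pair by (rule sqrt_sum_squares_le_sum) auto
          also have "\<dots> < \<rho>" using s e(1,3) \<rho>(1) by (simp add: dist_commute)
          finally show "norm (f\<^sub>1 (s, e) - m) \<le> \<bar>m\<bar> / 200" using \<rho>(2) by (simp add: less_imp_le)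
        qed (use ex[OF x(1)] ex[OF x(2)] e(4) in \<open>auto simp: dist_real_def\<close>)
        moreover have "norm ((a + e * x\<^sub>1) - (a + e * x\<^sub>2)) = e * \<bar>x\<^sub>1 - x\<^sub>2\<bar>"
          using e(1) by (simp add: abs_mult flip: right_diff_distrib)
        moreover have "(f (a + e * x\<^sub>1, e) - m * (a + e * x\<^sub>1)) - (f (a + e * x\<^sub>2, e) - m * (a + e * x\<^sub>2)) =
          f (a + e * x\<^sub>1, e) - f (a + e * x\<^sub>2, e) - e * m * (x\<^sub>1 - x\<^sub>2)"
          by (simp add: algebra_simps)
        ultimately show ?thesis by simp
      qed
      have "averaging ?N (e * m) (e * \<bar>m\<bar> / 100) B R"
      proof unfold_locales
        show "e * m \<noteq> 0" "\<bar>e * m\<bar> \<le> 1 / 100" "0 \<le> e * \<bar>m\<bar> / 100" "e * \<bar>m\<bar> / 100 \<le> \<bar>e * m\<bar> / 100"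
          using e(1,8) m0 by (auto simp: abs_mult)
        show "0 \<le> B" "6 * B \<le> R" by (rule B0, rule R)
        show N_per: "?N (t + 1) x y = ?N t x y" for t x y
          using \<gamma>(2) by (simp add: rescaled_rhs_def one_periodic_def)
        show N_cont: "continuous_on UNIV (\<lambda>t. ?N t (x t) (y t))"
          if x: "continuous_on UNIV x" "\<And>t. \<bar>x t\<bar> \<le> 9 * R"
            and y: "continuous_on UNIV y" "\<And>t. \<bar>y t\<bar> \<le> 9 * R" for x y
        proof -
          have ax: "continuous_on UNIV (\<lambda>t. a + e * x t)"
            by (intro continuous_on_add continuous_on_const continuous_on_mult_left x(1))
          have "continuous_on UNIV (\<lambda>s. F_prim f s e)"
            unfolding F_eq by (rule continuous_H_prim[OF fc])
          then have "continuous_on UNIV (\<lambda>t. F_prim f (a + e * x t) e)"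
            by (rule continuous_on_compose2[OF _ ax]) simp
          then have "continuous_on UNIV (\<lambda>t. ?E (x t) (y t))"
            unfolding rescaled_energy_def
            by (intro continuous_on_diff continuous_on_divide continuous_on_power continuous_on_const
                continuous_on_mult_left y(1)) auto
          then have "continuous_on UNIV (\<lambda>t. K (?E (x t) (y t)))"
            by (rule continuous_on_compose2[OF lipschitz_on_continuous_on[OF K(3)]])
               (use E x(2) y(2) in \<open>auto simp: Q_def simp del: mem_cball\<close>)
          moreover have "continuous_on UNIV (\<lambda>t. f (a + e * x t, e))"
            by (rule continuous_on_compose2[OF fc ax]) simp
          ultimately show ?thesis
            unfolding rescaled_rhs_def by (intro continuous_on_add continuous_on_mult \<gamma>(1))
        qed
        show "\<bar>?N t x\<^sub>1 y\<^sub>1 - ?N t x\<^sub>2 y\<^sub>2 - e * m * (x\<^sub>1 - x\<^sub>2)\<bar> \<le> e * \<bar>m\<bar> / 100 * (\<bar>x\<^sub>1 - x\<^sub>2\<bar> + \<bar>y\<^sub>1 - y\<^sub>2\<bar>)"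
          if b: "\<bar>x\<^sub>1\<bar> \<le> 9 * R" "\<bar>x\<^sub>2\<bar> \<le> 9 * R" "\<bar>y\<^sub>1\<bar> \<le> 9 * R" "\<bar>y\<^sub>2\<bar> \<le> 9 * R" for t x\<^sub>1 x\<^sub>2 y\<^sub>1 y\<^sub>2
        proof -
          note b' = b[folded Q_def]
          let ?\<sigma> = "\<bar>x\<^sub>1 - x\<^sub>2\<bar> + \<bar>y\<^sub>1 - y\<^sub>2\<bar>"
          have "\<bar>\<gamma> t * (K (?E x\<^sub>1 y\<^sub>1) - K (?E x\<^sub>2 y\<^sub>2))\<bar> \<le> \<Gamma> * L * \<bar>?E x\<^sub>1 y\<^sub>1 - ?E x\<^sub>2 y\<^sub>2\<bar>"
            by (intro K_lip E b')
          also have "\<dots> \<le> \<Gamma> * L * (e * e * (Q + \<Phi>) * ?\<sigma>)"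
            using \<Gamma>(1) K(2) by (intro mult_left_mono E_diff b') auto
          also have "\<dots> = (e * (\<Gamma> * L * (Q + \<Phi>))) * (e * ?\<sigma>)" by (simp only: mult_ac)
          also have "\<dots> \<le> \<bar>m\<bar> / 200 * (e * ?\<sigma>)"
            by (rule mult_right_mono[OF e(7)]) (use e(1) in auto)
          finally have 1: "\<bar>\<gamma> t * (K (?E x\<^sub>1 y\<^sub>1) - K (?E x\<^sub>2 y\<^sub>2))\<bar> \<le> \<bar>m\<bar> / 200 * (e * ?\<sigma>)" .
          have "\<bar>f (a + e * x\<^sub>1, e) - f (a + e * x\<^sub>2, e) - e * m * (x\<^sub>1 - x\<^sub>2)\<bar> \<le> \<bar>m\<bar> / 200 * (e * \<bar>x\<^sub>1 - x\<^sub>2\<bar>)"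
            by (rule f_incr[OF b'(1,2)])
          also have "\<dots> \<le> \<bar>m\<bar> / 200 * (e * ?\<sigma>)"
            using e(1) by (intro mult_left_mono) auto
          finally have 2: "\<bar>f (a + e * x\<^sub>1, e) - f (a + e * x\<^sub>2, e) - e * m * (x\<^sub>1 - x\<^sub>2)\<bar> \<le> \<bar>m\<bar> / 200 * (e * ?\<sigma>)" .
          have "?N t x\<^sub>1 y\<^sub>1 - ?N t x\<^sub>2 y\<^sub>2 - e * m * (x\<^sub>1 - x\<^sub>2) =
            (f (a + e * x\<^sub>1, e) - f (a + e * x\<^sub>2, e) - e * m * (x\<^sub>1 - x\<^sub>2)) + \<gamma> t * (K (?E x\<^sub>1 y\<^sub>1) - K (?E x\<^sub>2 y\<^sub>2))"
            by (simp add: rescaled_rhs_def algebra_simps)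
          with 1 2 have "\<bar>?N t x\<^sub>1 y\<^sub>1 - ?N t x\<^sub>2 y\<^sub>2 - e * m * (x\<^sub>1 - x\<^sub>2)\<bar> \<le> 2 * (\<bar>m\<bar> / 200 * (e * ?\<sigma>))"
            by linarith
          also have "\<dots> = e * \<bar>m\<bar> / 100 * ?\<sigma>" by simp
          finally show ?thesis .
        qed
        \<comment> \<open>The limit of \<open>N t 0 0\<close> as \<open>e\<close> tends to
          0.\<close>
        define g where "g = (\<lambda>t. f (a, 0) + \<gamma> t * K (-d))"
        have N0: "\<bar>?N t 0 0 - g t\<bar> \<le> e * A" for t
        proof -
          have "norm (f (a, e) - f (a, 0)) \<le> L\<^sub>2 * norm (e - 0)"
          proof (rule field_differentiable_bound[where S = "{0..1}" and f' = "\<lambda>s. f\<^sub>2 (a, s)"])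
            show "norm (f\<^sub>2 (a, s)) \<le> L\<^sub>2" if "s \<in> {0..1}" for s
              using that L\<^sub>2(2)[of "(a, s)"] by (simp add: box_def) linarith
          qed (use e(1,2) f\<^sub>2(1) in \<open>auto intro: has_field_derivative_at_within\<close>)
          then have 1: "\<bar>f (a, e) - f (a, 0)\<bar> \<le> e * L\<^sub>2" using e(1) by (simp add: mult.commute)
          have "\<bar>\<gamma> t * (K (?E 0 0) - K (-d))\<bar> \<le> \<Gamma> * L * \<bar>?E 0 0 - -d\<bar>"
            using E[of 0 0] Q0 K(1) by (intro K_lip) auto
          also have "\<bar>?E 0 0 - -d\<bar> = e * \<bar>F_prim f a e\<bar>"
            using e(1) by (simp add: rescaled_energy_def abs_mult)
          also have "\<Gamma> * L * (e * \<bar>F_prim f a e\<bar>) \<le> \<Gamma> * L * (e * \<Psi>)"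
            using F1[of 0] Q0 e(1) \<Gamma>(1) K(2) by (intro mult_left_mono) auto
          finally have 2: "\<bar>\<gamma> t * (K (?E 0 0) - K (-d))\<bar> \<le> e * (\<Gamma> * L * \<Psi>)" by (simp add: mult_ac)
          have "?N t 0 0 - g t = (f (a, e) - f (a, 0)) + \<gamma> t * (K (?E 0 0) - K (-d))"
            by (simp add: rescaled_rhs_def g_def algebra_simps)
          with 1 2 show ?thesis unfolding A_def distrib_left by linarith
        qed
        have eA: "e * A \<le> A" using mult_right_mono[OF e(2) A0] by simp
        show "\<bar>?N t 0 0\<bar> \<le> B" for t
        proof -
          have "\<bar>\<gamma> t * K (-d)\<bar> \<le> \<Gamma> * \<bar>K (-d)\<bar>"
            unfolding abs_mult by (rule mult_right_mono[OF \<Gamma>(2)]) simp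
          moreover have "A / \<bar>m\<bar> \<ge> 0" using A0 by simp
          ultimately show ?thesis
            using N0[of t] eA unfolding B_def g_def by linarith
        qed
        have cN: "continuous_on UNIV (\<lambda>t. ?N t 0 0)"
          using N_cont[of "\<lambda>_. 0" "\<lambda>_. 0"] R B0 by simp
        have cg: "continuous_on UNIV g" unfolding g_def by (intro continuous_intros \<gamma>(1))
        have "H_prim g 1 = f (a, 0) + K (-d) * H_prim \<gamma> 1"
          unfolding g_def
          by (subst H_prim_add)
             (auto intro!: continuous_intros \<gamma>(1) simp: H_prim_const H_prim_cmult[OF \<gamma>(1)] mult.commute[of _ "K (-d)"])
        \<comment> \<open>The mean of \<open>g\<close> is the averaged function at \<open>a\<close>,
          which is zero. Subtracting \<open>g\<close> therefore leaves the mean unchanged and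
          exposes its order \<open>e\<close>.\<close>
        then have "H_prim (\<lambda>t. ?N t 0 0) 1 = H_prim (\<lambda>t. ?N t 0 0 - g t) 1"
          using zero by (simp add: H_prim_diff[OF cN cg])
        also have "\<bar>\<dots>\<bar> \<le> e * A"
          by (rule H_prim_bound) (use N0 in \<open>auto intro!: continuous_on_diff cN cg\<close>)
        also have "e * A = (A / \<bar>m\<bar>) * \<bar>e * m\<bar>" using e(1) m0 by (simp add: abs_mult)
        also have "\<dots> \<le> B * \<bar>e * m\<bar>"
          unfolding B_def using \<Gamma>(1) A0 by (intro mult_right_mono) auto
        finally show "\<bar>H_prim (\<lambda>t. ?N t 0 0) 1\<bar> \<le> B * \<bar>e * m\<bar>" .
      qed
      with E show "averaging ?N (e * m) (e * \<bar>m\<bar> / 100) B R \<and>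
        (\<forall>x y. \<bar>x\<bar> \<le> Q \<longrightarrow> \<bar>y\<bar> \<le> Q \<longrightarrow> ?E x y \<in> cball (-d) r)" by blast
    qed
  qed
qed

section \<open>The \<open>C2_norm\<close> of periodic functions as pointwise bounds\<close>

lemma bdd_above_abs_periodic:
  assumes "continuous_on UNIV u" "one_periodic u"
  shows "bdd_above (range (\<lambda>t. \<bar>u t\<bar>))"
  using one_periodic_bounded[OF assms] by (metis bdd_above.I2)

text \<open>Periodicity is inherited by both derivatives and makes all three suprema finite; a real
  \<open>SUP\<close> of an unbounded family would carry no information.\<close>

lemma C2_norm_le_iff:
  assumes "\<And>t. (u has_real_derivative v t) (at t)" "\<And>t. (v has_real_derivative w t) (at t)"
    and "continuous_on UNIV w" "one_periodic u"
  shows "C2_norm u \<le> c \<longleftrightarrow> (\<forall>t. \<bar>u t\<bar> \<le> c \<and> \<bar>v t\<bar> \<le> c \<and> \<bar>w t\<bar> \<le> c)"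
proof -
  have v: "deriv u = v" and w: "deriv v = w"
    using DERIV_imp_deriv assms(1,2) by blast+
  have pv: "one_periodic v" by (rule one_periodic_derivative[OF assms(4,1)])
  have pw: "one_periodic w" by (rule one_periodic_derivative[OF pv assms(2)])
  have sup: "(SUP t. \<bar>g t\<bar>) \<le> c \<longleftrightarrow> (\<forall>t. \<bar>g t\<bar> \<le> c)"
    if "continuous_on UNIV g" "one_periodic g" for g :: "real \<Rightarrow> real"
    using cSUP_le_iff[OF _ bdd_above_abs_periodic[OF that]] by simp
  show ?thesis
    unfolding C2_norm_def v w
    using sup[OF has_derivative_imp_continuous[OF assms(1)] assms(4)]
      sup[OF has_derivative_imp_continuous[OF assms(2)] pv] sup[OF assms(3) pw]
    by auto
qed

theorem theorem4:
  fixes f :: "real \<times> real \<Rightarrow> real" and h \<gamma> :: "real \<Rightarrow> real"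
    and d \<alpha>\<^sub>0 :: real and I J :: "real set"
  assumes "Ck_on 2 f UNIV" and "Ck_on 2 h UNIV"
    and "Ck_on 2 \<gamma> UNIV" and "one_periodic \<gamma>"
    and "open I" and "is_interval I" and "open J" and "is_interval J"
    and "diffeo_onto (H_prim h) I J"
    and "-d \<in> J"
    and "M_aver f h \<gamma> d I \<alpha>\<^sub>0 = 0" and "deriv (M_aver f h \<gamma> d I) \<alpha>\<^sub>0 \<noteq> 0"
  shows "\<exists>C\<^sub>0>0. \<forall>C\<ge>C\<^sub>0. \<exists>\<epsilon>\<^sub>0>0. \<forall>\<epsilon>. 0 < \<epsilon> \<and> \<epsilon> < \<epsilon>\<^sub>0 \<longrightarrow>
    (\<exists>!\<psi>. is_solution f h \<gamma> d I J \<epsilon> \<psi> \<and> one_periodic \<psi> \<and>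
           C2_norm (\<lambda>t. \<psi> t - \<alpha>\<^sub>0) \<le> C * \<epsilon>)"
proof -
  define G where "G = inv_into I (H_prim h)"
  define K where "K = (\<lambda>z. h (G z))"
  note f1 = Ck_on_2_imp_1[OF assms(1)]
  have f_cont: "continuous_on UNIV f"
    using f1 Ck_on_Suc_imp_continuous_on unfolding One_nat_def by blast
  obtain f\<^sub>1 f\<^sub>2 where f\<^sub>1: "\<And>s e. ((\<lambda>s. f (s, e)) has_real_derivative f\<^sub>1 (s, e)) (at s)"
    and f\<^sub>2: "\<And>s e. ((\<lambda>e. f (s, e)) has_real_derivative f\<^sub>2 (s, e)) (at e)"
    and fc: "continuous_on UNIV f\<^sub>1" "continuous_on UNIV f\<^sub>2"
    using partial_derivatives[OF f1] by blast
  have h': "(h has_real_derivative deriv h z) (at z)" "continuous_on UNIV (deriv h)" for z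
    using Ck_on_2_imp_1[OF assms(2)] Ck_on_Suc_real[of 0 h UNIV z] Ck_on_1_deriv_continuous[of h UNIV]
    by (simp_all only: One_nat_def UNIV_I)
  have G1: "Ck_on 1 G J" using assms(9) by (simp add: diffeo_onto_def G_def)
  then have G': "(G has_real_derivative deriv G z) (at z)" if "z \<in> J" for z
    using that Ck_on_Suc_real[of 0] by (simp add: One_nat_def)
  have Gc: "continuous_on J G"
    using G' DERIV_isCont continuous_at_imp_continuous_on by blast
  have K': "(K has_real_derivative deriv h (G z) * deriv G z) (at z)" if "z \<in> J" for z
    unfolding K_def using DERIV_chain2[OF h'(1) G'[OF that]] .
  have K'c: "continuous_on J (\<lambda>z. deriv h (G z) * deriv G z)"
    by (intro continuous_intros Ck_on_1_deriv_continuous[OF G1] continuous_on_compose2[OF h'(2) Gc]) auto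
  \<comment> \<open>The ball lies in \<open>J\<close>, so keeping the rescaled energy in it also
    secures the domain condition of \<open>is_solution\<close>.\<close>
  obtain r L where r: "r > 0" "cball (-d) r \<subseteq> J" and L: "L \<ge> 0" "L-lipschitz_on (cball (-d) r) K"
    using locally_Lipschitz[OF assms(7,10) K' K'c] by blast
  have \<gamma>: "continuous_on UNIV \<gamma>"
    using assms(3) Ck_on_Suc_imp_continuous_on unfolding numeral_2_eq_2 by blast
  have M: "M_aver f h \<gamma> d I s = f (s, 0) + K (-d) * H_prim \<gamma> 1" for s
    by (simp add: M_aver_def K_def G_def H_prim_def one_ereal_def)
  have "(M_aver f h \<gamma> d I has_real_derivative f\<^sub>1 (\<alpha>\<^sub>0, 0)) (at \<alpha>\<^sub>0)"
    unfolding M by (auto intro!: derivative_eq_intros f\<^sub>1)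
  then have simple: "f\<^sub>1 (\<alpha>\<^sub>0, 0) \<noteq> 0" using assms(12) DERIV_imp_deriv by metis
  have zero: "f (\<alpha>\<^sub>0, 0) + K (-d) * H_prim \<gamma> 1 = 0" using M assms(11) by simp
  obtain B where B: "B \<ge> 0" and ev: "\<And>R. 6 * B \<le> R \<Longrightarrow> \<forall>\<^sub>F e in at_right 0.
     averaging (rescaled_rhs f K \<gamma> d \<alpha>\<^sub>0 e) (e * f\<^sub>1 (\<alpha>\<^sub>0, 0)) (e * \<bar>f\<^sub>1 (\<alpha>\<^sub>0, 0)\<bar> / 100) B R \<and>
     (\<forall>x y. \<bar>x\<bar> \<le> 9 * R \<longrightarrow> \<bar>y\<bar> \<le> 9 * R \<longrightarrow> rescaled_energy f d \<alpha>\<^sub>0 e x y \<in> cball (-d) r)"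
    using rescaled_averaging[OF f_cont f\<^sub>1 fc(1) f\<^sub>2 fc(2) r(1) L \<gamma> assms(4) zero simple] by blast
  show ?thesis
  \<comment> \<open>\<open>54 * B\<close> bounds the rescaled solution and its derivatives; the
    added 1 keeps the constant positive when \<open>B = 0\<close>.\<close>
  proof (rule exI[of _ "54 * B + 1"], intro conjI allI impI)
    show "0 < 54 * B + 1" using B by simp
    fix C assume C: "54 * B + 1 \<le> C"
    \<comment> \<open>With this radius the bound \<open>R / 2\<close> required for uniqueness is
      exactly \<open>C\<close>.\<close>
    define R where "R = 2 * C"
    have R: "6 * B \<le> R" "R / 2 = C" "C \<le> 9 * R" using B C by (auto simp: R_def)
    obtain e0 where e0: "e0 > 0" "\<And>e. 0 < e \<Longrightarrow> e < e0 \<Longrightarrow>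
       averaging (rescaled_rhs f K \<gamma> d \<alpha>\<^sub>0 e) (e * f\<^sub>1 (\<alpha>\<^sub>0, 0)) (e * \<bar>f\<^sub>1 (\<alpha>\<^sub>0, 0)\<bar> / 100) B R \<and>
       (\<forall>x y. \<bar>x\<bar> \<le> 9 * R \<longrightarrow> \<bar>y\<bar> \<le> 9 * R \<longrightarrow> rescaled_energy f d \<alpha>\<^sub>0 e x y \<in> cball (-d) r)"
      using ev[OF R(1)] unfolding eventually_at_right_field by blast
    show "\<exists>\<epsilon>\<^sub>0>0. \<forall>\<epsilon>. 0 < \<epsilon> \<and> \<epsilon> < \<epsilon>\<^sub>0 \<longrightarrow>
      (\<exists>!\<psi>. is_solution f h \<gamma> d I J \<epsilon> \<psi> \<and> one_periodic \<psi> \<and>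
           C2_norm (\<lambda>t. \<psi> t - \<alpha>\<^sub>0) \<le> C * \<epsilon>)"
    proof (rule exI[of _ e0], intro conjI allI impI; (elim conjE)?)
      show "e0 > 0" by (rule e0)
      fix e assume e: "0 < e" "e < e0"
      let ?N = "rescaled_rhs f K \<gamma> d \<alpha>\<^sub>0 e"
      interpret averaging ?N "e * f\<^sub>1 (\<alpha>\<^sub>0, 0)" "e * \<bar>f\<^sub>1 (\<alpha>\<^sub>0, 0)\<bar> / 100" B R
        using e0(2)[OF e] by blast
      have E: "rescaled_energy f d \<alpha>\<^sub>0 e x y \<in> J" if "\<bar>x\<bar> \<le> 9 * R" "\<bar>y\<bar> \<le> 9 * R" for x y
        using e0(2)[OF e] that r(2) by blast
      show "\<exists>!\<psi>. is_solution f h \<gamma> d I J e \<psi> \<and> one_periodic \<psi> \<and>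
           C2_norm (\<lambda>t. \<psi> t - \<alpha>\<^sub>0) \<le> C * e"
      proof (rule ex_ex1I)
        obtain x y where sol: "periodic_sol x y" and bd: "\<And>t. \<bar>x t\<bar> \<le> 54 * B"
          "\<And>t. \<bar>y t\<bar> \<le> 54 * B" "\<And>t. \<bar>?N t (x t) (y t)\<bar> \<le> 54 * B"
          using periodic_sol_exists by blast
        have x': "(x has_real_derivative y t) (at t)"
          and y': "(y has_real_derivative ?N t (x t) (y t)) (at t)" and px: "one_periodic x" for t
          using sol by (auto simp: periodic_sol_def)
        \<comment> \<open>Undoing the scaling: the bounds \<open>54 * B \<le> C\<close> on
          \<open>x\<close>, \<open>y\<close> and \<open>x''\<close> become \<open>C * e\<close> for
          \<open>\<psi> - \<alpha>\<^sub>0\<close> and its derivatives.\<close>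
        define \<psi> where "\<psi> = (\<lambda>t. \<alpha>\<^sub>0 + e * x t)"
        have bd9: "\<bar>x t\<bar> \<le> 9 * R" "\<bar>y t\<bar> \<le> 9 * R" for t
          using bd(1)[of t] bd(2)[of t] C R(3) by linarith+
        have cN: "continuous_on UNIV (\<lambda>t. e * ?N t (x t) (y t))"
          by (intro continuous_on_mult_left continuous bd9
              has_derivative_imp_continuous[OF x'] has_derivative_imp_continuous[OF y'])
        have \<psi>': "(\<psi> has_real_derivative e * y t) (at t)" for t
          unfolding \<psi>_def by (auto intro!: derivative_eq_intros x')
        have \<psi>'': "((\<lambda>t. e * y t) has_real_derivative e * ?N t (x t) (y t)) (at t)" for t
          by (rule DERIV_cmult[OF y'])
        have dd: "deriv \<psi> = (\<lambda>t. e * y t)" "deriv (\<lambda>t. e * y t) = (\<lambda>t. e * ?N t (x t) (y t))"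
          using DERIV_imp_deriv[OF \<psi>'] DERIV_imp_deriv[OF \<psi>''] by auto
        have en: "energy f d e \<psi> t = rescaled_energy f d \<alpha>\<^sub>0 e (x t) (y t)" for t
          by (simp add: energy_def rescaled_energy_def dd) (simp add: \<psi>_def)
        have "Ck_on 2 \<psi> UNIV" 
          unfolding Ck_on_2_real_iff by (intro exI conjI allI) (rule \<psi>' \<psi>'' cN)+
        then have "is_solution f h \<gamma> d I J e \<psi>"
          using E[OF bd9] unfolding is_solution_def en dd
          by (simp add: rescaled_rhs_def K_def G_def \<psi>_def algebra_simps)
        moreover have "one_periodic \<psi>" using px by (simp add: \<psi>_def one_periodic_def)
        moreover have "C2_norm (\<lambda>t. \<psi> t - \<alpha>\<^sub>0) \<le> C * e"
        proof (subst C2_norm_le_iff)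
          show "((\<lambda>t. \<psi> t - \<alpha>\<^sub>0) has_real_derivative e * y t) (at t)" for t
            using DERIV_diff[OF \<psi>' DERIV_const] by simp
          have "\<bar>e * s\<bar> \<le> C * e" if "\<bar>s\<bar> \<le> 54 * B" for s
            using e(1) that C by (simp add: abs_mult mult.commute)
          then show "\<forall>t. \<bar>\<psi> t - \<alpha>\<^sub>0\<bar> \<le> C * e \<and> \<bar>e * y t\<bar> \<le> C * e \<and> \<bar>e * ?N t (x t) (y t)\<bar> \<le> C * e"
            using bd by (simp add: \<psi>_def)
        qed (use \<psi>'' cN px in \<open>auto simp: \<psi>_def one_periodic_def\<close>)
        ultimately show "\<exists>\<psi>. is_solution f h \<gamma> d I J e \<psi> \<and> one_periodic \<psi> \<and>
           C2_norm (\<lambda>t. \<psi> t - \<alpha>\<^sub>0) \<le> C * e" by blast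
      next
        \<comment> \<open>Dividing by \<open>e\<close> turns any competitor into a solution of the
          rescaled problem with bounds \<open>C = R / 2\<close>, which is what
          \<open>periodic_sol_unique\<close> asks for.\<close>
        have rescale: "periodic_sol (\<lambda>t. (\<psi> t - \<alpha>\<^sub>0) / e) (\<lambda>t. deriv \<psi> t / e) \<and>
            (\<forall>t. \<bar>(\<psi> t - \<alpha>\<^sub>0) / e\<bar> \<le> C \<and> \<bar>deriv \<psi> t / e\<bar> \<le> C \<and>
               \<bar>?N t ((\<psi> t - \<alpha>\<^sub>0) / e) (deriv \<psi> t / e)\<bar> \<le> C)"
          if "is_solution f h \<gamma> d I J e \<psi> \<and> one_periodic \<psi> \<and> C2_norm (\<lambda>t. \<psi> t - \<alpha>\<^sub>0) \<le> C * e" for \<psi>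
        proof -
          define N' where "N' = (\<lambda>t. ?N t ((\<psi> t - \<alpha>\<^sub>0) / e) (deriv \<psi> t / e))"
          have "Ck_on 2 \<psi> UNIV" using that by (simp add: is_solution_def)
          then obtain g g' where g: "\<And>t. (\<psi> has_real_derivative g t) (at t)"
            "\<And>t. (g has_real_derivative g' t) (at t)" "continuous_on UNIV g'"
            unfolding Ck_on_2_real_iff by auto
          have dd: "deriv \<psi> = g" "deriv g = g'"
            using DERIV_imp_deriv g(1,2) by blast+
          have en: "energy f d e \<psi> t = rescaled_energy f d \<alpha>\<^sub>0 e ((\<psi> t - \<alpha>\<^sub>0) / e) (deriv \<psi> t / e)" for t
            using e(1) by (simp add: energy_def rescaled_energy_def)
          have g': "g' t = e * N' t" for t
            using that e(1) unfolding is_solution_def en dd N'_def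
            by (simp add: rescaled_rhs_def K_def G_def distrib_left mult.assoc)
          have "C2_norm (\<lambda>t. \<psi> t - \<alpha>\<^sub>0) \<le> C * e \<longleftrightarrow>
            (\<forall>t. \<bar>\<psi> t - \<alpha>\<^sub>0\<bar> \<le> C * e \<and> \<bar>g t\<bar> \<le> C * e \<and> \<bar>g' t\<bar> \<le> C * e)"
          proof (rule C2_norm_le_iff)
            show "((\<lambda>t. \<psi> t - \<alpha>\<^sub>0) has_real_derivative g t) (at t)" for t
              using DERIV_diff[OF g(1) DERIV_const] by simp
          qed (use g that in \<open>auto simp: one_periodic_def\<close>)
          then have b: "\<bar>\<psi> t - \<alpha>\<^sub>0\<bar> \<le> C * e" "\<bar>g t\<bar> \<le> C * e" "\<bar>e * N' t\<bar> \<le> C * e" for t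
            using that by (auto simp: g')
          have "((\<lambda>t. (\<psi> t - \<alpha>\<^sub>0) / e) has_real_derivative g t / e) (at t)" for t
            using DERIV_cdivide[OF DERIV_diff[OF g(1) DERIV_const]] by simp
          moreover have "((\<lambda>t. g t / e) has_real_derivative N' t) (at t)" for t
            using DERIV_cdivide[OF g(2), of e t] e(1) by (simp add: g')
          moreover have "\<bar>(\<psi> t - \<alpha>\<^sub>0) / e\<bar> \<le> C" "\<bar>g t / e\<bar> \<le> C" "\<bar>N' t\<bar> \<le> C" for t
            using b[of t] e(1) by (auto simp: abs_divide abs_mult pos_divide_le_eq mult.commute)
          ultimately show ?thesis
            using that unfolding N'_def dd periodic_sol_def by (simp add: one_periodic_def)
        qed
        fix \<psi> \<phi>
        assume "is_solution f h \<gamma> d I J e \<psi> \<and> one_periodic \<psi> \<and> C2_norm (\<lambda>t. \<psi> t - \<alpha>\<^sub>0) \<le> C * e"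
          and "is_solution f h \<gamma> d I J e \<phi> \<and> one_periodic \<phi> \<and> C2_norm (\<lambda>t. \<phi> t - \<alpha>\<^sub>0) \<le> C * e"
        then have "(\<lambda>t. (\<psi> t - \<alpha>\<^sub>0) / e) = (\<lambda>t. (\<phi> t - \<alpha>\<^sub>0) / e)"
          using rescale[of \<psi>] rescale[of \<phi>] unfolding R(2)[symmetric]
          by (intro periodic_sol_unique[where y = "\<lambda>t. deriv \<psi> t / e" and y' = "\<lambda>t. deriv \<phi> t / e"]) blast+
        then show "\<psi> = \<phi>" using e(1) by (simp add: fun_eq_iff)
      qed
    qed
  qed
qed

end
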